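(* Let $N\ge2$ be an integer, $m\in\mathbb{Z}$ and $t=\lfloor m/(N+1)\rfloor$. Then $\langle W_m\rangle^{{\rm SU}(N)_{-N-1}}(x;q)$ equals \[ \frac{1}{(q;q)_\infty}x^{-m}q^{(m-N)t+m/2}\frac{1-q^{Nt}}{1-q^t}\sum_{k\in\mathbb{Z}}(-1)^{Nk}x^{Nk}q^{Nk^2/2-mk}\quad\text{if } m\equiv0\pmod{N+1}, \] and \[ -\frac{1}{(q;q)_\infty}x^{-m}q^{mt+m/2}\sum_{k\in\mathbb{Z}}(-1)^{Nk}x^{Nk}q^{Nk^2/2-mk}\quad\text{if } m\not\equiv0\pmod{N+1}, \] where for $t=0$ the quotient $\frac{1-q^{Nt}}{1-q^t}$ is understood as $1+q^t+\dots+q^{(N-1)t}=N$.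
   Context: Let $|q|<1$, $x$ a nonzero parameter, $(a;q)_\infty=\prod_{k\ge0}(1-aq^k)$. Let $s_1,\dots,s_{N-1}$ be variables and $s_N:=(s_1\cdots s_{N-1})^{-1}$. For $m\in\mathbb{Z}$ define \[ \langle W_m\rangle^{{\rm SU}(N)_{-N-1}}(x;q):=\frac{(q;q)_\infty^{N-1}}{N!}\oint\prod_{i=1}^{N-1}\frac{ds_i}{2\pi i s_i}\prod_{\substack{i,j=1\\ i\ne j}}^N(s_is_j^{-1};q)_\infty\prod_{i=1}^N(q^{1/2}s_ix;q)_\infty(q^{1/2}s_i^{-1}x^{-1};q)_\infty\sum_{i=1}^N s_i^m, \] where the integral denotes the constant term in $s_1,\dots,s_{N-1}$ of the integrand expanded as a formal Laurent series in the $s_i$ (equivalently the contour integral over unit circles). *)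

theory Defs
  imports "HOL-Analysis.Analysis"
begin

definition qpoch :: "complex \<Rightarrow> complex \<Rightarrow> complex" where
  "qpoch a q = (\<Prod>k. (1 - a * q ^ k))"

definition svar :: "nat \<Rightarrow> (nat \<Rightarrow> real) \<Rightarrow> nat \<Rightarrow> complex" where
  "svar N \<theta> i = (if i < N - 1 then cis (\<theta> i) else inverse (\<Prod>j<N - 1. cis (\<theta> j)))"

definition Wintegrand :: "nat \<Rightarrow> int \<Rightarrow> complex \<Rightarrow> complex \<Rightarrow> (nat \<Rightarrow> real) \<Rightarrow> complex" where
  "Wintegrand N m x p \<theta> =
     (let q = p ^ 2; s = svar N \<theta> in
      (\<Prod>i<N. \<Prod>j\<in>{..<N} - {i}. qpoch (s i / s j) q)
      * (\<Prod>i<N. qpoch (p * s i * x) q * qpoch (p / (s i * x)) q)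
      * (\<Sum>i<N. s i powi m))"

(* <W_m>^{SU(N)_{-N-1}}(x;q) with q = p^2: the contour integral over the unit torus
   (1/(2\<pi> i))^{N-1} \<oint> \<Prod> ds_i/s_i, written as the normalized integral over
   \<theta> \<in> [0,2\<pi>]^{N-1} *)
definition Wm :: "nat \<Rightarrow> int \<Rightarrow> complex \<Rightarrow> complex \<Rightarrow> complex" where
  "Wm N m x p =
     qpoch (p^2) (p^2) ^ (N - 1) / of_nat (fact N) *
     (LINT \<theta> | Pi\<^sub>M {..<N - 1} (\<lambda>_. uniform_measure lborel {0..2 * pi}). Wintegrand N m x p \<theta>)"

end

theory Submission
  imports
    Defs
    "HOL-Probability.Probability"
    "Jordan_Normal_Form.Determinant"
begin

text \<open>
  Let $n = N + 1$ and $y_i = s_i x$ for $i < N$, $y_N = q^{-1/2}$. Then the integrand is $q^{N/2} x^{-m}$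
  times the affine denominator $A(y) = \prod_{i<j<n} y_j\,(y_i/y_j;q)_\infty (q y_j/y_i;q)_\infty$ of type
  $A_{n-1}$, times the Vandermonde product in the $y_i^{-1}$, times $\sum_i y_i^m$. The function $A$ is
  antisymmetric, homogeneous, and quasi-periodic under $y_i \mapsto q y_i$. Consequently its Laurent coefficient at
  $c \in \mathbb{Z}^n$ vanishes unless $c$ is a permutation of $(0, \ldots, n - 1)$ modulo $n$, and all
  coefficients are explicit multiples of a single one. That one is found by setting
  $y_i = e^{2 \pi \mathrm{i} i / n}$, where the remaining lattice sum is the generating function of $n$-cores and
  is evaluated by the Jacobi triple product. The constant term in the theorem then only
  involves the $N$ coefficients at $(0, \ldots, N) + m (e_N - e_l)$, $l < N$: if $n$ divides $m$
  they form a geometric progression, and otherwise all but one of them vanish.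
\<close>

subsection \<open>The Jacobi triple product\<close>

text \<open>The value \<open>y N = 1 / p\<close> is chosen because
  \<open>y i / y N = p * s i * x\<close> and \<open>q * y N / y i = p / (s i * x)\<close>: the
  factors that contain \<open>x\<close> become the missing theta factors, so that one function of
  \<open>N + 1\<close> variables carries everything. The symmetries of $A$ are linear and therefore
  leave a constant undetermined. Fixing it takes a point where both the product and the series can
  be evaluated. At n-th roots of unity every monomial with exponents in n Z^n equals 1, so the sum
  over the lattice separates from the signed sum over permutations, and the latter is a Vandermonde
  product that does not vanish and cancels. The answer is a series in \<open>x\<close> because the
  product of the \<open>s i\<close> is 1: a whole line of exponents with direction (1, ..., 1, -N)
  contributes to the constant term, and quasi-periodicity in the last variable turns the
  coefficients along this line into theta coefficients. The parameter is \<open>p\<close> with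
  \<open>q = p ^ 2\<close>, so that half-integral powers of \<open>q\<close> are integral powers of
  \<open>p\<close>.\<close>

lemma qpoch_LIMSEQ:
  fixes a q :: complex
  assumes "norm q < 1"
  shows "(\<lambda>n. \<Prod>k<n. 1 - a * q ^ k) \<longlonglongrightarrow> qpoch a q"
proof -
  have "summable (\<lambda>k. norm a * norm q ^ k)"
    using assms by (intro summable_mult summable_geometric) auto
  then have "abs_convergent_prod (\<lambda>k. 1 - a * q ^ k)"
    by (intro summable_imp_abs_convergent_prod) (simp add: norm_mult norm_power)
  then have "convergent_prod (\<lambda>k. 1 - a * q ^ k)"
    by (rule abs_convergent_prod_imp_convergent_prod)
  from convergent_prod_LIMSEQ[OF this] show ?thesis
    unfolding qpoch_def
    by (subst LIMSEQ_lessThan_iff_atMost)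
qed

lemma qpoch_rec:
  assumes "norm q < 1"
  shows "qpoch a q = (1 - a) * qpoch (a * q) q"
proof (rule LIMSEQ_unique)
  show "(\<lambda>n. \<Prod>k<Suc n. 1 - a * q ^ k) \<longlonglongrightarrow> qpoch a q"
    using qpoch_LIMSEQ[OF assms, of a] by (rule LIMSEQ_Suc)
  have "(\<lambda>n. (1 - a) * (\<Prod>k<n. 1 - (a * q) * q ^ k)) \<longlonglongrightarrow> (1 - a) * qpoch (a * q) q"
    by (intro tendsto_mult_left qpoch_LIMSEQ assms)
  then show "(\<lambda>n. \<Prod>k<Suc n. 1 - a * q ^ k) \<longlonglongrightarrow> (1 - a) * qpoch (a * q) q"
    unfolding prod.lessThan_Suc_shift by (simp add: o_def mult_ac)
qed

lemma qpoch_nonzero: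
  assumes "norm q < 1" "\<And>k. a * q ^ k \<noteq> 1"
  shows "qpoch a q \<noteq> 0"
proof -
  have "summable (\<lambda>k. norm a * norm q ^ k)"
    using assms by (intro summable_mult summable_geometric) auto
  then have "abs_convergent_prod (\<lambda>k. 1 - a * q ^ k)"
    by (intro summable_imp_abs_convergent_prod) (simp add: norm_mult norm_power)
  then show ?thesis
    unfolding qpoch_def using assms(2)
    by (intro prodinf_nonzero abs_convergent_prod_imp_convergent_prod) auto
qed

lemma power_Suc_neq_1:
  fixes q :: complex
  assumes "norm q < 1"
  shows "q ^ Suc k \<noteq> 1"
proof
  assume "q ^ Suc k = 1"
  then have "norm q ^ Suc k = 1" by (metis norm_one norm_power)
  moreover have "norm q ^ Suc k < 1"
    using assms by (simp only: power_less_one_iff[OF norm_ge_zero] zero_less_Suc simp_thms)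
  ultimately show False by simp
qed

lemma qpoch_self_nonzero:
  assumes "norm q < 1"
  shows "qpoch q q \<noteq> 0"
  using power_Suc_neq_1[OF assms] by (intro qpoch_nonzero assms) (simp only: power_Suc not_False_eq_True)

section \<open>Finite products and the finite form of the triple product\<close>

definition qfact :: "complex \<Rightarrow> nat \<Rightarrow> complex" where
  "qfact q n = (\<Prod>k<n. 1 - q ^ Suc k)"

definition inv_qfact :: "complex \<Rightarrow> int \<Rightarrow> complex" where
  "inv_qfact q m = (if m < 0 then 0 else inverse (qfact q (nat m)))"

text \<open>The zero extension is compatible with the recursion: at \<open>m = 0\<close> the factor
  \<open>1 - q powi m\<close> vanishes, and for negative \<open>m\<close> both sides are 0. Holding
  for every integer, the rule spares all boundary cases in the induction on the finite
  product.\<close>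

lemma inv_qfact_rec:
  assumes "norm q < 1" "q \<noteq> 0"
  shows "inv_qfact q (m - 1) = (1 - q powi m) * inv_qfact q m"
proof (cases "m \<le> 0")
  case True
  then show ?thesis by (cases "m = 0") (auto simp: inv_qfact_def)
next
  case False
  then obtain k where k: "m = int (Suc k)"
    by (metis not_less zero_less_imp_eq_int gr0_implies_Suc not_le)
  have "1 - q ^ Suc k \<noteq> 0"
    using power_Suc_neq_1[OF assms(1)] by simp
  moreover have "qfact q (Suc k) = qfact q k * (1 - q ^ Suc k)"
    by (simp add: qfact_def)
  moreover have "q powi m = q ^ Suc k" "nat m = Suc k" "nat (m - 1) = k"
    by (simp only: k power_int_of_nat, use k in simp_all)
  moreover have "\<not> m < 0" "\<not> m - 1 < 0" using False by simp_all
  ultimately show ?thesis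
    unfolding inv_qfact_def by (simp only: if_False inverse_mult_distrib) simp
qed

lemma qfact_LIMSEQ:
  assumes "norm q < 1"
  shows "qfact q \<longlonglongrightarrow> qpoch q q"
  using qpoch_LIMSEQ[OF assms, of q] by (simp add: qfact_def [abs_def])

text \<open>The coefficients are Gaussian binomials \<open>[2n choose n + k]\<close>; extending \<open>1 / (q;q)\<^sub>m\<close> by zero to
  negative \<open>m\<close> makes the sum range over all integers.\<close>

lemma finite_triple_product:
  fixes p z :: complex
  assumes p: "p \<noteq> 0" "norm p < 1" and z: "z \<noteq> 0"
  defines "q \<equiv> p\<^sup>2"
  shows "((\<lambda>k. (-1) powi k * (qfact q (2 * n) * inv_qfact q (int n - k) * inv_qfact q (int n + k))
            * p powi (k\<^sup>2) * z powi k)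
          has_sum (\<Prod>k<n. (1 - p * z * q ^ k) * (1 - p / z * q ^ k))) UNIV"
proof (induction n)
  case 0
  have "((\<lambda>k::int. if k = 0 then 1 else 0) has_sum (1::complex)) UNIV"
    by (rule has_sum_finite_neutralI[where B = "{0}"]) auto
  also have "(\<lambda>k::int. if k = 0 then 1 else (0::complex)) =
      (\<lambda>k. (-1) powi k * (qfact q (2 * 0) * inv_qfact q (int 0 - k) * inv_qfact q (int 0 + k))
            * p powi (k\<^sup>2) * z powi k)"
    by (auto simp: fun_eq_iff inv_qfact_def qfact_def)
  finally show ?case by simp
next
  case (Suc n)
  define c where "c n k = qfact q (2 * n) * inv_qfact q (int n - k) * inv_qfact q (int n + k)" for n k
  define f where "f n k = (-1) powi k * c n k * p powi (k\<^sup>2) * z powi k" for n k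
  define P where "P n = (\<Prod>k<n. (1 - p * z * q ^ k) * (1 - p / z * q ^ k))" for n
  have q: "q \<noteq> 0" "norm q < 1"
    using p by (auto simp: q_def norm_power power_less_one_iff)
  have IH: "(f n has_sum P n) UNIV"
    using Suc.IH unfolding f_def c_def P_def .
  have up: "((\<lambda>k. f n (k - 1)) has_sum P n) UNIV"
    by (subst has_sum_reindex_bij_witness[where i = "\<lambda>k. k + 1" and j = "\<lambda>k. k - 1" and T = UNIV and h = "f n" and s = "P n", OF _ _ _ _ _ refl])
       (auto simp: IH)
  have down: "((\<lambda>k. f n (k + 1)) has_sum P n) UNIV"
    by (subst has_sum_reindex_bij_witness[where i = "\<lambda>k. k - 1" and j = "\<lambda>k. k + 1" and T = UNIV and h = "f n" and s = "P n", OF _ _ _ _ _ refl])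
       (auto simp: IH)
  \<comment> \<open>The new factor of the product multiplies out to 1 + p^2 q^(2n) - p q^n z - p q^n
    / z, so the claim becomes a three-term recursion between neighbouring coefficients.\<close>
  have "((\<lambda>k. (1 + p\<^sup>2 * (q ^ n)\<^sup>2) * f n k + (- p * q ^ n * z) * f n (k - 1) + (- p * q ^ n / z) * f n (k + 1))
      has_sum ((1 + p\<^sup>2 * (q ^ n)\<^sup>2) * P n + (- p * q ^ n * z) * P n + (- p * q ^ n / z) * P n)) UNIV"
    by (intro has_sum_add has_sum_cmult_right IH up down)
  also have "((1 + p\<^sup>2 * (q ^ n)\<^sup>2) * P n + (- p * q ^ n * z) * P n + (- p * q ^ n / z) * P n) = P (Suc n)"
    using z by (simp add: P_def field_simps power2_eq_square)
  also have "(\<lambda>k. (1 + p\<^sup>2 * (q ^ n)\<^sup>2) * f n k + (- p * q ^ n * z) * f n (k - 1) + (- p * q ^ n / z) * f n (k + 1)) = f (Suc n)"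
  proof
    fix k :: int
    \<comment> \<open>All coefficients are reduced to the arguments \<open>a\<close> and
      \<open>b\<close> of row \<open>Suc n\<close>. With the powers \<open>A\<close>,
      \<open>B\<close> and the values \<open>ra\<close>, \<open>rb\<close> there, everything but the
      polynomial identity \<open>alg\<close> factors out.\<close>
    define a b where "a = int n + 1 - k" and "b = int n + 1 + k"
    define A B where "A = q powi a" and "B = q powi b"
    define ra rb where "ra = inv_qfact q a" and "rb = inv_qfact q b"
    note rec = inv_qfact_rec[OF q(2,1)]
    have AB: "A * B = q ^ (2 * n + 2)"
    proof -
      have "A * B = q powi (int (2 * n + 2))"
        unfolding A_def B_def a_def b_def using q by (simp add: power_int_add[symmetric] algebra_simps)
      then show ?thesis by (simp only: power_int_of_nat)
    qed
    have Am: "q powi (a - 1) = A / q" and Bm: "q powi (b - 1) = B / q"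
      using q by (simp_all add: A_def B_def power_int_diff)
    have r1: "inv_qfact q (int n - k) = (1 - A) * ra"
      using rec[of a] by (simp add: a_def A_def ra_def)
    have r2: "inv_qfact q (int n + k) = (1 - B) * rb"
      using rec[of b] by (simp add: b_def B_def rb_def)
    have r3: "inv_qfact q (int n - (k + 1)) = (1 - A / q) * ((1 - A) * ra)"
    proof -
      have "int n - (k + 1) = a - 1 - 1" by (simp add: a_def)
      then show ?thesis by (simp only: rec Am A_def[symmetric] ra_def[symmetric])
    qed
    have r4: "inv_qfact q (int n + (k - 1)) = (1 - B / q) * ((1 - B) * rb)"
    proof -
      have "int n + (k - 1) = b - 1 - 1" by (simp add: b_def)
      then show ?thesis by (simp only: rec Bm B_def[symmetric] rb_def[symmetric])
    qed
    have r5: "inv_qfact q (int n - (k - 1)) = ra" "inv_qfact q (int n + (k + 1)) = rb"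
             "inv_qfact q (int (Suc n) - k) = ra" "inv_qfact q (int (Suc n) + k) = rb"
      unfolding ra_def rb_def a_def b_def by (simp_all add: algebra_simps)
    have qf: "qfact q (2 * Suc n) = qfact q (2 * n) * (1 - A * B / q) * (1 - A * B)"
      unfolding qfact_def AB using q by simp
    define K where "K = (-1) powi k * p powi (k\<^sup>2) * z powi k"
    have e1: "(-1) powi (k - 1) * p powi ((k - 1)\<^sup>2) * z powi (k - 1) = - K * (p powi (1 - 2 * k)) / z"
    proof -
      have "p powi ((k - 1)\<^sup>2) = p powi (k\<^sup>2) * p powi (1 - 2 * k)"
        using p by (simp add: power_int_add[symmetric] power2_eq_square algebra_simps)
      then show ?thesis using z by (simp add: K_def power_int_diff)
    qed
    have e2: "(-1) powi (k + 1) * p powi ((k + 1)\<^sup>2) * z powi (k + 1) = - K * (p powi (1 + 2 * k)) * z"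
    proof -
      have "p powi ((k + 1)\<^sup>2) = p powi (k\<^sup>2) * p powi (1 + 2 * k)"
        using p by (simp add: power_int_add[symmetric] power2_eq_square algebra_simps)
      then show ?thesis using z by (simp add: K_def power_int_add)
    qed
    have pA: "p * q ^ n * p powi (1 - 2 * k) = A"
    proof -
      have "2 * a = 1 + 2 * int n + (1 - 2 * k)" by (simp add: a_def)
      then have "p powi (2 * a) = p powi 1 * p powi (2 * int n) * p powi (1 - 2 * k)"
        using p by (simp only: power_int_add simp_thms)
      then show ?thesis by (simp add: A_def q_def power_int_mult)
    qed
    have pB: "p * q ^ n * p powi (1 + 2 * k) = B"
    proof -
      have "2 * b = 1 + 2 * int n + (1 + 2 * k)" by (simp add: b_def)
      then have "p powi (2 * b) = p powi 1 * p powi (2 * int n) * p powi (1 + 2 * k)"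
        using p by (simp only: power_int_add simp_thms)
      then show ?thesis by (simp add: B_def q_def power_int_mult)
    qed
    have pq: "p\<^sup>2 * (q ^ n)\<^sup>2 = A * B / q"
      using q by (simp add: AB q_def power_mult_distrib power_mult[symmetric] power_add[symmetric] divide_simps)
    have F: "f n k = K * (qfact q (2 * n) * ((1 - A) * ra) * ((1 - B) * rb))"
      by (simp add: f_def c_def K_def r1 r2)
    have Fm: "(- p * q ^ n * z) * f n (k - 1) = K * A * (qfact q (2 * n) * ra * ((1 - B / q) * ((1 - B) * rb)))"
    proof -
      have "f n (k - 1) = (- K * (p powi (1 - 2 * k)) / z) * (qfact q (2 * n) * ra * ((1 - B / q) * ((1 - B) * rb)))"
        unfolding f_def c_def r4 r5 e1[symmetric] by (simp only: mult_ac)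
      then show ?thesis using z by (simp add: pA[symmetric])
    qed
    have Fp: "(- p * q ^ n / z) * f n (k + 1) = K * B * (qfact q (2 * n) * ((1 - A / q) * ((1 - A) * ra)) * rb)"
    proof -
      have "f n (k + 1) = (- K * (p powi (1 + 2 * k)) * z) * (qfact q (2 * n) * ((1 - A / q) * ((1 - A) * ra)) * rb)"
        unfolding f_def c_def r3 r5 e2[symmetric] by (simp only: mult_ac)
      then show ?thesis using z by (simp add: pB[symmetric])
    qed
    have G: "f (Suc n) k = K * (qfact q (2 * n) * (1 - A * B / q) * (1 - A * B) * ra * rb)"
      unfolding f_def c_def r5 qf K_def by (simp only: mult_ac)
    define X Y where "X = A / q" and "Y = B / q"
    have XY: "A = q * X" "B = q * Y" "A * B / q = q * X * Y"
      using q by (simp_all add: X_def Y_def)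
    have alg: "(1 + q * X * Y) * ((1 - A) * (1 - B)) + A * ((1 - Y) * (1 - B)) + B * ((1 - X) * (1 - A))
       = (1 - q * X * Y) * (1 - A * B)"
      unfolding XY(1,2) by (simp add: algebra_simps)
    have "(1 + p\<^sup>2 * (q ^ n)\<^sup>2) * f n k + (- p * q ^ n * z) * f n (k - 1) + (- p * q ^ n / z) * f n (k + 1)
      = K * qfact q (2 * n) * ra * rb * ((1 + q * X * Y) * ((1 - A) * (1 - B)) + A * ((1 - Y) * (1 - B)) + B * ((1 - X) * (1 - A)))"
      unfolding F Fm Fp pq XY(3) X_def[symmetric] Y_def[symmetric] by (simp add: algebra_simps)
    also have "\<dots> = f (Suc n) k"
      unfolding alg G XY(3) by (simp only: mult_ac)
    finally show "(1 + p\<^sup>2 * (q ^ n)\<^sup>2) * f n k + (- p * q ^ n * z) * f n (k - 1) + (- p * q ^ n / z) * f n (k + 1) = f (Suc n) k" .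
  qed
  finally show ?case unfolding f_def c_def P_def .
qed

text \<open>The \<open>k\<close>-th term is \<open>(r ^ k * w) ^ k\<close>, and
  \<open>r ^ k * w\<close> tends to 0, so a geometric series of ratio 1/2 eventually
  dominates.\<close>

lemma summable_theta_nat:
  fixes r w :: real
  assumes "0 \<le> r" "r < 1" "0 \<le> w"
  shows "summable (\<lambda>k::nat. r ^ (k\<^sup>2) * w ^ k)"
proof (rule summable_comparison_test_ev)
  have "(\<lambda>k. r ^ k * w) \<longlonglongrightarrow> 0 * w"
    using assms by (intro tendsto_mult_right LIMSEQ_realpow_zero) auto
  then have "eventually (\<lambda>k. r ^ k * w < 1 / 2) sequentially"
    by (rule order_tendstoD) simp
  then show "eventually (\<lambda>k. norm (r ^ (k\<^sup>2) * w ^ k) \<le> (1 / 2) ^ k) sequentially"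
  proof eventually_elim
    case (elim k)
    have "norm (r ^ (k\<^sup>2) * w ^ k) = (r ^ k * w) ^ k"
      using assms by (simp add: power_mult_distrib power2_eq_square power_mult)
    also have "\<dots> \<le> (1 / 2) ^ k"
      using elim assms by (intro power_mono) auto
    finally show ?case .
  qed
qed (simp add: summable_geometric)

lemma summable_on_theta:
  fixes p z :: complex
  assumes "norm p < 1" "z \<noteq> 0"
  shows "(\<lambda>k::int. norm (p powi (k\<^sup>2) * z powi k)) summable_on UNIV"
proof -
  have half: "(\<lambda>k::int. norm (p powi (k\<^sup>2) * w powi k)) summable_on {0..}" if "w \<noteq> 0" for w :: complex
  proof -
    have "(\<lambda>k::nat. norm p ^ (k\<^sup>2) * norm w ^ k) summable_on UNIV"
      using assms by (intro summable_nonneg_imp_summable_on summable_theta_nat) auto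
    also have "(\<lambda>k::nat. norm p ^ (k\<^sup>2) * norm w ^ k) = (\<lambda>k. norm (p powi (k\<^sup>2) * w powi k)) \<circ> int"
    proof
      fix k :: nat
      have "p powi ((int k)\<^sup>2) = p ^ (k\<^sup>2)"
        by (metis of_nat_power power_int_of_nat)
      then show "norm p ^ (k\<^sup>2) * norm w ^ k = ((\<lambda>k. norm (p powi (k\<^sup>2) * w powi k)) \<circ> int) k"
        by (simp add: norm_mult norm_power)
    qed
    finally have "(\<lambda>k. norm (p powi (k\<^sup>2) * w powi k)) summable_on (range int)"
      by (rule summable_on_reindex[THEN iffD2, rotated]) simp
    also have "range int = {0..}"
      by (auto intro: zero_le_imp_eq_int elim!: nonneg_int_cases)
    finally show ?thesis .
  qed
  have "(\<lambda>k::int. norm (p powi (k\<^sup>2) * z powi k)) summable_on {..0}"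
  proof -
    have "(\<lambda>k::int. norm (p powi (k\<^sup>2) * (inverse z) powi k)) summable_on {0..}"
      using assms by (intro half) auto
    also have "?this \<longleftrightarrow> ?thesis"
      by (rule summable_on_reindex_bij_witness[where i = uminus and j = uminus])
         (auto simp: power_int_minus power_int_inverse)
    finally show ?thesis .
  qed
  moreover have "{0..} \<union> {..0} = (UNIV :: int set)" by auto
  ultimately show ?thesis
    using summable_on_union[OF half[OF assms(2)]] by metis
qed

text \<open>Letting \<open>n\<close> tend to infinity in the finite form: each Gaussian binomial
  tends to \<open>1 / qpoch q q\<close>, and a bound uniform in \<open>n\<close> and
  \<open>k\<close> lets the limit pass under the sum.\<close>

theorem jacobi_triple_product:
  fixes p z :: complex
  assumes p: "p \<noteq> 0" "norm p < 1" and z: "z \<noteq> 0"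
  shows "((\<lambda>k. (-1) powi k * p powi (k\<^sup>2) * z powi k)
          has_sum (qpoch (p\<^sup>2) (p\<^sup>2) * qpoch (p * z) (p\<^sup>2) * qpoch (p / z) (p\<^sup>2))) UNIV"
proof -
  define q where "q = p\<^sup>2"
  define Q where "Q = qpoch q q"
  define t where "t k = (-1) powi k * p powi (k\<^sup>2) * z powi k" for k :: int
  define c where "c n k = qfact q (2 * n) * inv_qfact q (int n - k) * inv_qfact q (int n + k)" for n k
  have q: "q \<noteq> 0" "norm q < 1"
    using p by (auto simp: q_def norm_power power_less_one_iff)
  have Q: "Q \<noteq> 0" using qpoch_self_nonzero[OF q(2)] by (simp add: Q_def)
  have lim_r: "(\<lambda>n. inverse (qfact q n)) \<longlonglongrightarrow> inverse Q"
    using Q by (intro tendsto_inverse qfact_LIMSEQ[OF q(2), folded Q_def])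
  have lim_c: "(\<lambda>n. c n k) \<longlonglongrightarrow> inverse Q" for k
  proof -
    have "(\<lambda>n. inv_qfact q (int n + k)) \<longlonglongrightarrow> inverse Q" for k
    proof -
      have "filterlim (\<lambda>n. nat (int n + k)) at_top sequentially"
        unfolding filterlim_at_top eventually_at_top_linorder
      proof
        fix Z :: nat
        show "\<exists>M. \<forall>n\<ge>M. Z \<le> nat (int n + k)"
          by (rule exI[of _ "Z + nat \<bar>k\<bar>"]) auto
      qed
      then have "(\<lambda>n. inverse (qfact q (nat (int n + k)))) \<longlonglongrightarrow> inverse Q"
        by (rule filterlim_compose[OF lim_r])
      moreover have "eventually (\<lambda>n. inverse (qfact q (nat (int n + k))) = inv_qfact q (int n + k)) sequentially"
        using eventually_ge_at_top[of "nat \<bar>k\<bar>"] by eventually_elim (auto simp: inv_qfact_def)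
      ultimately show ?thesis
        by (rule Lim_transform_eventually)
    qed
    from this[of k] this[of "- k"]
    have "(\<lambda>n. c n k) \<longlonglongrightarrow> Q * inverse Q * inverse Q"
      unfolding c_def
      by (intro tendsto_mult filterlim_compose[OF qfact_LIMSEQ[OF q(2), folded Q_def] mult_nat_left_at_top]) simp_all
    then show ?thesis using Q by simp
  qed
  \<comment> \<open>Both \<open>qfact q n\<close> and its inverse converge, the latter since the
    limit \<open>Q\<close> is nonzero; hence all Gaussian binomials share one bound.\<close>
  obtain M where M: "\<And>n k. norm (c n k) \<le> M"
  proof -
    obtain M1 where M1: "\<And>n. norm (qfact q n) \<le> M1"
      using convergent_imp_Bseq[OF convergentI[OF qfact_LIMSEQ[OF q(2)]]] unfolding Bseq_def by blast
    obtain M2 where M2: "M2 > 0" "\<And>n. norm (inverse (qfact q n)) \<le> M2"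
      using convergent_imp_Bseq[OF convergentI[OF lim_r]] unfolding Bseq_def by blast
    have r: "norm (inv_qfact q k) \<le> M2" for k
      using M2 by (auto simp: inv_qfact_def less_imp_le)
    have "norm (c n k) \<le> M1 * M2 * M2" for n k
      unfolding c_def norm_mult using M2(1) order_trans[OF norm_ge_zero M1[of 0]]
      by (intro mult_mono M1 r mult_nonneg_nonneg) simp_all
    then show ?thesis using that by blast
  qed
  have sum_t: "(\<lambda>k. norm (t k)) summable_on UNIV"
    using summable_on_theta[OF p(2) z] by (simp add: t_def norm_mult norm_power_int)
  have bij: "bij_betw int_decode UNIV UNIV"
    by (rule bij_int_decode)
  \<comment> \<open>Tannery's theorem speaks of series over the naturals, so the integers are
    enumerated by \<open>int_decode\<close>; the dominating series is \<open>M\<close> times the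
    norms of the theta terms.\<close>
  have tann: "summable (\<lambda>k. norm (inverse Q * t (int_decode k))) \<and>
    ((\<lambda>n. \<Sum>k. c n (int_decode k) * t (int_decode k)) \<longlonglongrightarrow> (\<Sum>k. inverse Q * t (int_decode k)))"
  proof (rule conjunct2[OF tannerys_theorem])
    show "(\<lambda>n. c n (int_decode k) * t (int_decode k)) \<longlonglongrightarrow> inverse Q * t (int_decode k)" for k
      by (intro tendsto_mult_right lim_c)
    show "eventually (\<lambda>(k,n). norm (c n (int_decode k) * t (int_decode k)) \<le> M * norm (t (int_decode k)))
       (at_top \<times>\<^sub>F sequentially)"
      by (intro always_eventually) (auto simp: norm_mult intro!: mult_right_mono M)
    have "(\<lambda>k. norm (t (int_decode k))) summable_on UNIV"
      using sum_t summable_on_reindex_bij_betw[OF bij, of "\<lambda>k. norm (t k)"] by simp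
    then show "summable (\<lambda>k. M * norm (t (int_decode k)))"
      by (intro summable_mult summable_on_imp_summable)
  qed simp
  have fin: "(\<lambda>k. c n (int_decode k) * t (int_decode k)) sums
      (\<Prod>k<n. (1 - p * z * q ^ k) * (1 - p / z * q ^ k))" for n
  proof -
    have "((\<lambda>k. c n k * t k) has_sum (\<Prod>k<n. (1 - p * z * q ^ k) * (1 - p / z * q ^ k))) UNIV"
      using finite_triple_product[OF p z, of n] unfolding c_def t_def q_def by (simp add: mult_ac)
    then have "((\<lambda>k. c n (int_decode k) * t (int_decode k)) has_sum (\<Prod>k<n. (1 - p * z * q ^ k) * (1 - p / z * q ^ k))) UNIV"
      using has_sum_reindex_bij_betw[OF bij, of "\<lambda>k. c n k * t k"] by simp
    then show ?thesis by (rule has_sum_imp_sums)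
  qed
  have "(\<lambda>n. \<Sum>k. c n (int_decode k) * t (int_decode k)) \<longlonglongrightarrow> qpoch (p * z) q * qpoch (p / z) q"
    using tendsto_mult[OF qpoch_LIMSEQ[OF q(2), of "p * z"] qpoch_LIMSEQ[OF q(2), of "p / z"]]
    unfolding sums_unique[OF fin, symmetric] by (simp add: prod.distrib)
  then have eq: "(\<Sum>k. inverse Q * t (int_decode k)) = qpoch (p * z) q * qpoch (p / z) q"
    using tann LIMSEQ_unique by blast
  have "((\<lambda>k. inverse Q * t (int_decode k)) has_sum (qpoch (p * z) q * qpoch (p / z) q)) UNIV"
    using tann eq summable_norm_cancel[OF conjunct1[OF tann]]
    by (intro norm_summable_imp_has_sum) (simp_all only: sums_iff simp_thms)
  then have "((\<lambda>k. inverse Q * t k) has_sum (qpoch (p * z) q * qpoch (p / z) q)) UNIV"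
    using has_sum_reindex_bij_betw[OF bij, of "\<lambda>k. inverse Q * t k"] by simp
  from has_sum_cmult_right[OF this, of Q] have "(t has_sum (Q * (qpoch (p * z) q * qpoch (p / z) q))) UNIV"
    using Q by (simp add: mult.assoc[symmetric])
  then show ?thesis
    unfolding t_def Q_def q_def by (simp only: mult.assoc)
qed

subsection \<open>Laurent series on the torus\<close>

abbreviation circle_measure :: "real measure" where
  "circle_measure \<equiv> uniform_measure lborel {0..2 * pi}"

abbreviation torus :: "nat \<Rightarrow> (nat \<Rightarrow> real) measure" where
  "torus M \<equiv> Pi\<^sub>M {..<M} (\<lambda>_. circle_measure)"

lemma prob_space_circle: "prob_space circle_measure"
  by (rule prob_space_uniform_measure) auto

lemma prob_space_torus: "prob_space (torus M)"
  by (intro prob_space_PiM prob_space_circle)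

lemma measurable_circle_powi: "(\<lambda>t. cis t powi k) \<in> borel_measurable circle_measure"
proof -
  have "(\<lambda>t. cis t powi k) \<in> borel_measurable lborel"
    unfolding cis_power_int measurable_lborel2
    by (intro borel_measurable_continuous_onI continuous_intros)
  then show ?thesis
    by (simp only: measurable_cong_sets[OF sets_uniform_measure refl])
qed

lemma integral_circle_powi: "(LINT t|circle_measure. cis t powi k) = (if k = 0 then 1 else 0)"
proof -
  have "circle_measure = density lborel (\<lambda>t. ennreal (indicator {0..2 * pi} t / (2 * pi)))"
    unfolding uniform_measure_def
    by (intro arg_cong2[where f = density] refl ext) (auto simp: indicator_def divide_ennreal ennreal_1[symmetric] simp del: ennreal_1)
  then have "(LINT t|circle_measure. cis t powi k) = (LINT t|lborel. (indicator {0..2 * pi} t / (2 * pi)) *\<^sub>R cis (of_int k * t))"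
    unfolding cis_power_int
    by (simp only:) (intro integral_density; simp add: borel_measurable_continuous_onI continuous_intros)
  also have "\<dots> = (1 / (2 * pi)) *\<^sub>R (LINT t|lborel. indicator {0..2 * pi} t *\<^sub>R cis (of_int k * t))"
    by (subst integral_scaleR_right[symmetric]) (simp_all add: mult.commute)
  also have "\<dots> = (if k = 0 then 1 else 0)"
  proof (cases "k = 0")
    case True
    then show ?thesis
      by (simp add: scaleR_conv_of_real)
  next
    case False
    define F where "F t = (1 / (\<i> * of_int k)) * cis (of_int k * t)" for t :: real
    have "has_bochner_integral lborel (\<lambda>t. indicator {0..2 * pi} t *\<^sub>R cis (of_int k * t)) (F (2 * pi) - F 0)"
    proof (rule has_bochner_integral_FTC_Icc)
      show "(F has_vector_derivative cis (of_int k * t)) (at t within {0..2 * pi})" for t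
      proof -
        have "((\<lambda>z. exp (\<i> * of_int k * z) / (\<i> * of_int k)) has_field_derivative exp (\<i> * of_int k * of_real t)) (at (of_real t))"
          using False by (auto intro!: derivative_eq_intros)
        from has_vector_derivative_real_field[OF this]
        have "((\<lambda>t. exp (\<i> * of_int k * of_real t) / (\<i> * of_int k)) has_vector_derivative exp (\<i> * of_int k * of_real t)) (at t within {0..2 * pi})"
          by (rule has_vector_derivative_at_within)
        then show ?thesis
          by (simp add: F_def[abs_def] cis_conv_exp mult_ac)
      qed
    qed (auto intro!: continuous_intros)
    moreover have "F (2 * pi) = F 0"
      using cis_multiple_2pi[of "of_int k"] by (simp add: F_def mult_ac)
    ultimately show ?thesis
      using False by (simp add: has_bochner_integral_integral_eq)
  qed
  finally show ?thesis .
qed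

text \<open>Converts an unconditional sum over a countable set, finite or not, into a zero-padded
  sum over the naturals, the form in which termwise integration is applied.\<close>

lemma has_sum_to_nat_on:
  assumes "countable C"
  shows "((\<lambda>k. if k \<in> to_nat_on C ` C then h (from_nat_into C k) else 0) has_sum S) UNIV \<longleftrightarrow> (h has_sum S) C"
proof -
  have "((\<lambda>k. if k \<in> to_nat_on C ` C then h (from_nat_into C k) else 0) has_sum S) UNIV
     \<longleftrightarrow> ((\<lambda>k. h (from_nat_into C k)) has_sum S) (to_nat_on C ` C)"
    by (rule has_sum_cong_neutral) auto
  also have "\<dots> \<longleftrightarrow> ((\<lambda>k. h (from_nat_into C k)) \<circ> to_nat_on C has_sum S) C"
    using assms by (intro has_sum_reindex) auto
  also have "\<dots> \<longleftrightarrow> (h has_sum S) C"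
    using assms by (intro has_sum_cong) auto
  finally show ?thesis .
qed

section \<open>Termwise integration over the torus\<close>

lemma torus_integral_monom:
  shows "integrable (torus M) (\<lambda>\<theta>. \<Prod>i<M. cis (\<theta> i) powi v i)"
    and "(LINT \<theta>|torus M. (\<Prod>i<M. cis (\<theta> i) powi v i)) = (if \<forall>i<M. v i = 0 then 1 else 0)"
proof -
  interpret prob_space circle_measure by (rule prob_space_circle)
  interpret product_sigma_finite "\<lambda>_. circle_measure" ..
  have int: "integrable circle_measure (\<lambda>t. cis t powi k)" for k
    by (rule integrable_const_bound[where B = 1]) (auto simp: norm_power_int measurable_circle_powi)
  show "integrable (torus M) (\<lambda>\<theta>. \<Prod>i<M. cis (\<theta> i) powi v i)"
    by (rule product_integrable_prod) (auto intro: int)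
  have "(LINT \<theta>|torus M. (\<Prod>i<M. cis (\<theta> i) powi v i)) = (\<Prod>i<M. LINT t|circle_measure. cis t powi v i)"
    by (rule product_integral_prod) (auto intro: int)
  then show "(LINT \<theta>|torus M. (\<Prod>i<M. cis (\<theta> i) powi v i)) = (if \<forall>i<M. v i = 0 then 1 else 0)"
    by (auto simp: integral_circle_powi)
qed

text \<open>Monomials have modulus 1 on the torus, so the norms of the terms do not depend on the
  point and absolute convergence justifies integrating term by term. Only the indices with trivial
  monomial survive. The exponent map \<open>\<phi>\<close> is arbitrary because in later uses many
  indices share a monomial, for instance when only the sum of a lattice vector is recorded.\<close>

lemma torus_integral_has_sum:
  fixes f :: "'a \<Rightarrow> complex" and \<phi> :: "'a \<Rightarrow> nat \<Rightarrow> int"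
  assumes C: "countable C"
    and F: "\<And>\<theta>. ((\<lambda>c. f c * (\<Prod>i<M. cis (\<theta> i) powi \<phi> c i)) has_sum F \<theta>) C"
  shows "integrable (torus M) F"
    and "(f has_sum (LINT \<theta>|torus M. F \<theta>)) {c \<in> C. \<forall>i<M. \<phi> c i = 0}"
proof -
  interpret prob_space "torus M" by (rule prob_space_torus)
  let ?I = "to_nat_on C ` C"
  define h where "h \<theta> c = f c * (\<Prod>i<M. cis (\<theta> i) powi \<phi> c i)" for \<theta> c
  define g where "g k \<theta> = (if k \<in> ?I then h \<theta> (from_nat_into C k) else 0)" for k \<theta>
  have nh: "norm (h \<theta> c) = norm (f c)" for \<theta> c
    by (simp add: h_def norm_mult prod_norm[symmetric] norm_power_int)
  have g_sum: "((\<lambda>k. g k \<theta>) has_sum F \<theta>) UNIV" for \<theta>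
    unfolding g_def using F[of \<theta>] by (subst has_sum_to_nat_on[OF C]) (simp add: h_def[abs_def])
  have g_norm: "summable (\<lambda>k. norm (g k \<theta>))" for \<theta>
    using g_sum[of \<theta>, THEN has_sum_imp_summable]
    by (intro summable_on_imp_summable) (simp add: summable_on_iff_abs_summable_on_complex)
  have g_norm': "norm (g k \<theta>) = norm (g k (\<lambda>_. 0))" for k \<theta>
    by (simp add: g_def nh)
  have g_int: "integrable (torus M) (g k)" for k
    unfolding g_def h_def by (cases "k \<in> ?I") (auto intro!: torus_integral_monom)
  have g_val: "(LINT \<theta>|torus M. g k \<theta>) = (if k \<in> ?I then (\<lambda>c. if \<forall>i<M. \<phi> c i = 0 then f c else 0) (from_nat_into C k) else 0)" for k
    unfolding g_def h_def by (cases "k \<in> ?I") (auto simp: torus_integral_monom)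
  have F_eq: "F = (\<lambda>\<theta>. \<Sum>k. g k \<theta>)"
    using g_sum by (auto simp: fun_eq_iff intro!: sums_unique has_sum_imp_sums)
  have ng: "(LINT \<theta>|torus M. norm (g k \<theta>)) = norm (g k (\<lambda>_. 0))" for k
    by (subst g_norm') (simp add: prob_space)
  have s1: "AE \<theta> in torus M. summable (\<lambda>k. norm (g k \<theta>))"
    using g_norm by simp
  have s2: "summable (\<lambda>k. LINT \<theta>|torus M. norm (g k \<theta>))"
    using g_norm by (simp add: ng)
  show "integrable (torus M) F"
    unfolding F_eq by (rule integrable_suminf[OF g_int s1 s2])
  have sums: "(\<lambda>k. LINT \<theta>|torus M. g k \<theta>) sums (LINT \<theta>|torus M. F \<theta>)"
    unfolding F_eq by (rule sums_integral[OF g_int s1 s2])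
  have "summable (\<lambda>k. norm (LINT \<theta>|torus M. g k \<theta>))"
  proof (rule summable_comparison_test'[OF s2])
    show "norm (norm (LINT \<theta>|torus M. g n \<theta>)) \<le> (LINT \<theta>|torus M. norm (g n \<theta>))" for n
      by simp
  qed
  then have "((\<lambda>k. LINT \<theta>|torus M. g k \<theta>) has_sum (LINT \<theta>|torus M. F \<theta>)) UNIV"
    using sums by (rule norm_summable_imp_has_sum)
  then have "((\<lambda>c. if \<forall>i<M. \<phi> c i = 0 then f c else 0) has_sum (LINT \<theta>|torus M. F \<theta>)) C"
    unfolding g_val by (subst (asm) has_sum_to_nat_on[OF C])
  then show "(f has_sum (LINT \<theta>|torus M. F \<theta>)) {c \<in> C. \<forall>i<M. \<phi> c i = 0}"
    by (rule has_sum_cong_neutral[THEN iffD1, rotated -1]) auto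
qed

text \<open>Exponent vectors in $\mathbb{Z}^n$ are functions on the naturals that vanish from \<open>n\<close> on.\<close>

definition exponents :: "nat \<Rightarrow> (nat \<Rightarrow> int) set" where
  "exponents n = {b. \<forall>i\<ge>n. b i = 0}"

text \<open>Convergence is demanded at all points with nonzero coordinates and not just on the unit
  torus, since expansions are later evaluated at rescaled arguments such as \<open>2 * y i\<close>,
  \<open>q * y m\<close>, \<open>x * svar N \<theta> i\<close> and \<open>1 / p\<close>.\<close>

definition laurent :: "nat \<Rightarrow> ((nat \<Rightarrow> int) \<Rightarrow> complex) \<Rightarrow> ((nat \<Rightarrow> complex) \<Rightarrow> complex) \<Rightarrow> bool" where
  "laurent n c F \<longleftrightarrow> (\<forall>y. (\<forall>i<n. y i \<noteq> 0) \<longrightarrow>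
     ((\<lambda>b. c b * (\<Prod>i<n. y i powi b i)) has_sum F y) (exponents n))"

lemma laurentD:
  "laurent n c F \<Longrightarrow> (\<And>i. i < n \<Longrightarrow> y i \<noteq> 0) \<Longrightarrow>
     ((\<lambda>b. c b * (\<Prod>i<n. y i powi b i)) has_sum F y) (exponents n)"
  by (auto simp: laurent_def)

lemma bij_betw_exponents_PiE:
  "bij_betw (\<lambda>b. restrict b {..<n}) (exponents n) (PiE {..<n} (\<lambda>_. UNIV))"
  by (rule bij_betwI[where g = "\<lambda>b i. if i < n then b i else 0"])
     (auto simp: exponents_def fun_eq_iff restrict_def PiE_def extensional_def)

lemma countable_exponents: "countable (exponents n)"
proof -
  have "countable (PiE {..<n} (\<lambda>_. UNIV :: int set))"
    by (intro countable_PiE) auto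
  then show ?thesis
    using bij_betw_exponents_PiE[of n] by (metis bij_betw_imp_inj_on bij_betw_imp_surj_on countable_image_inj_on)
qed

text \<open>Integrating the function against the inverse monomial over the unit torus recovers each
  coefficient, as in Cauchy's formula.\<close>

lemma laurent_unique:
  assumes c: "laurent n c F" and d: "laurent n d F" and b: "b \<in> exponents n"
  shows "c b = d b"
proof -
  have *: "c b = (LINT \<theta>|torus n. F (\<lambda>i. cis (\<theta> i)) * (\<Prod>i<n. cis (\<theta> i) powi (- b i)))"
    if c: "laurent n c F" for c
  proof -
    have "((\<lambda>b'. c b' * (\<Prod>i<n. cis (\<theta> i) powi (b' i - b i))) has_sum
        (F (\<lambda>i. cis (\<theta> i)) * (\<Prod>i<n. cis (\<theta> i) powi (- b i)))) (exponents n)" for \<theta>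
    proof -
      have "((\<lambda>b'. c b' * (\<Prod>i<n. cis (\<theta> i) powi b' i)) has_sum F (\<lambda>i. cis (\<theta> i))) (exponents n)"
        by (rule laurentD[OF c]) simp
      from has_sum_cmult_left[OF this, of "\<Prod>i<n. cis (\<theta> i) powi (- b i)"] show ?thesis
        by (simp add: mult.assoc prod.distrib[symmetric] power_int_add[symmetric])
    qed
    from torus_integral_has_sum(2)[OF countable_exponents this]
    have "(c has_sum (LINT \<theta>|torus n. F (\<lambda>i. cis (\<theta> i)) * (\<Prod>i<n. cis (\<theta> i) powi (- b i))))
       {b' \<in> exponents n. \<forall>i<n. b' i - b i = 0}" .
    also have "{b' \<in> exponents n. \<forall>i<n. b' i - b i = 0} = {b}"
      using b by (auto simp: exponents_def fun_eq_iff not_le) (metis not_le)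
    finally show ?thesis
      by (simp add: has_sum_finite_iff)
  qed
  show ?thesis using *[OF c] *[OF d] by simp
qed

lemma laurent_cong:
  assumes "laurent n c F" "\<And>y. (\<And>i. i < n \<Longrightarrow> y i \<noteq> 0) \<Longrightarrow> F y = G y"
  shows "laurent n c G"
  using assms by (auto simp: laurent_def)

lemma laurent_const: "laurent n (\<lambda>b. if b = (\<lambda>_. 0) then a else 0) (\<lambda>_. a)"
  unfolding laurent_def
proof (intro allI impI)
  fix y :: "nat \<Rightarrow> complex"
  have "((\<lambda>b. if b = (\<lambda>_. 0) then a else 0) has_sum a) (exponents n)"
    by (rule has_sum_finite_neutralI[where B = "{\<lambda>_. 0}"]) (auto simp: exponents_def)
  then show "((\<lambda>b. (if b = (\<lambda>_. 0) then a else 0) * (\<Prod>i<n. y i powi b i)) has_sum a) (exponents n)"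
    by (rule has_sum_cong[THEN iffD1, rotated]) auto
qed

lemma has_sum_product:
  fixes f :: "'a \<Rightarrow> complex" and g :: "'b \<Rightarrow> complex"
  assumes f: "(f has_sum S) A" and g: "(g has_sum T) B"
  shows "((\<lambda>(x, y). f x * g y) has_sum S * T) (A \<times> B)"
proof -
  have abs_f: "(\<lambda>x. norm (f x)) summable_on A" and abs_g: "(\<lambda>y. norm (g y)) summable_on B"
    using f[THEN has_sum_imp_summable] g[THEN has_sum_imp_summable]
    by (simp_all only: summable_on_iff_abs_summable_on_complex[symmetric])
  have "(\<lambda>z. norm ((\<lambda>(x, y). f x * g y) z)) summable_on (A \<times> B)"
  proof (subst Infinite_Sum.abs_summable_on_Sigma_iff, intro conjI ballI)
    show "(\<lambda>y. norm (case (x, y) of (x, y) \<Rightarrow> f x * g y)) summable_on B" for x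
      using summable_on_cmult_right[OF abs_g, of "norm (f x)"] by (simp add: norm_mult)
    have "(\<lambda>x. norm (f x) * (\<Sum>\<^sub>\<infinity>y\<in>B. norm (g y))) summable_on A"
      by (rule summable_on_cmult_left[OF abs_f])
    then show "(\<lambda>x. norm (\<Sum>\<^sub>\<infinity>y\<in>B. norm (case (x, y) of (x, y) \<Rightarrow> f x * g y))) summable_on A"
      by (simp add: norm_mult infsum_cmult_right' infsum_nonneg)
  qed
  then have sum: "(\<lambda>(x, y). f x * g y) summable_on (A \<times> B)"
    by (rule abs_summable_summable)
  then have "(\<Sum>\<^sub>\<infinity>(x, y)\<in>A \<times> B. f x * g y) = (\<Sum>\<^sub>\<infinity>x\<in>A. \<Sum>\<^sub>\<infinity>y\<in>B. f x * g y)"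
    by (subst infsum_Sigma'_banach) auto
  also have "\<dots> = S * T"
    using f g by (simp add: infsum_cmult_right' infsum_cmult_left' infsumI)
  finally show ?thesis
    using sum by (simp add: has_sum_iff)
qed

lemma laurent_cmult:
  assumes "laurent n c F"
  shows "laurent n (\<lambda>b. a * c b) (\<lambda>y. a * F y)"
  using assms unfolding laurent_def mult.assoc by (auto intro: has_sum_cmult_right)

lemma laurent_monom_mult:
  assumes c: "laurent n c F" and v: "v \<in> exponents n"
  shows "laurent n (\<lambda>e. c (\<lambda>i. e i - v i)) (\<lambda>y. (\<Prod>i<n. y i powi v i) * F y)"
  unfolding laurent_def
proof (intro allI impI)
  fix y :: "nat \<Rightarrow> complex" assume y: "\<forall>i<n. y i \<noteq> 0"
  have "((\<lambda>b. (\<Prod>i<n. y i powi v i) * (c b * (\<Prod>i<n. y i powi b i))) has_sum (\<Prod>i<n. y i powi v i) * F y) (exponents n)"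
    using y by (intro has_sum_cmult_right laurentD[OF c]) auto
  also have "?this \<longleftrightarrow> ((\<lambda>e. c (\<lambda>i. e i - v i) * (\<Prod>i<n. y i powi e i)) has_sum (\<Prod>i<n. y i powi v i) * F y) (exponents n)"
  proof (rule has_sum_reindex_bij_witness[where j = "\<lambda>b i. b i + v i" and i = "\<lambda>e i. e i - v i"])
    fix b
    have "(\<Prod>i<n. y i powi (b i + v i)) = (\<Prod>i<n. y i powi v i) * (\<Prod>i<n. y i powi b i)"
      using y unfolding prod.distrib[symmetric] by (intro prod.cong) (auto simp: power_int_add)
    then show "c (\<lambda>i. b i + v i - v i) * (\<Prod>i<n. y i powi (b i + v i)) = (\<Prod>i<n. y i powi v i) * (c b * (\<Prod>i<n. y i powi b i))"
      by simp
  qed (use v in \<open>auto simp: exponents_def\<close>)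
  finally show "((\<lambda>e. c (\<lambda>i. e i - v i) * (\<Prod>i<n. y i powi e i)) has_sum (\<Prod>i<n. y i powi v i) * F y) (exponents n)" .
qed

text \<open>The substitution sending a pair of exponents to their sum and the first of them turns
  the double sum into an iterated one whose inner sums are the convolution.\<close>

lemma laurent_mult:
  assumes c: "laurent n c F" and d: "laurent n d G"
  shows "laurent n (\<lambda>e. \<Sum>\<^sub>\<infinity>b\<in>exponents n. c b * d (\<lambda>i. e i - b i)) (\<lambda>y. F y * G y)"
  unfolding laurent_def
proof (intro allI impI)
  fix y :: "nat \<Rightarrow> complex" assume y: "\<forall>i<n. y i \<noteq> 0"
  let ?B = "exponents n"
  define m where "m b = (\<Prod>i<n. y i powi b i)" for b
  define h where "h = (\<lambda>(e, b). c b * d (\<lambda>i. e i - b i) * m e)"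
  have "((\<lambda>(b, b'). (c b * m b) * (d b' * m b')) has_sum F y * G y) (?B \<times> ?B)"
    using laurentD[OF c, of y] laurentD[OF d, of y] y unfolding m_def by (intro has_sum_product) auto
  also have "?this \<longleftrightarrow> (h has_sum F y * G y) (?B \<times> ?B)"
  proof (rule has_sum_reindex_bij_witness[where i = "\<lambda>(e, b). (b, \<lambda>i. e i - b i)" and j = "\<lambda>(b, b'). (\<lambda>i. b i + b' i, b)"])
    fix x assume "x \<in> ?B \<times> ?B"
    obtain b b' where x: "x = (b, b')" by (cases x)
    have "m (\<lambda>i. b i + b' i) = m b * m b'"
      using y unfolding m_def prod.distrib[symmetric] by (intro prod.cong) (auto simp: power_int_add)
    then show "h (case x of (b, b') \<Rightarrow> (\<lambda>i. b i + b' i, b)) = (case x of (b, b') \<Rightarrow> (c b * m b) * (d b' * m b'))"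
      unfolding x h_def prod.case by (simp add: mult_ac)
  qed (auto simp: exponents_def)
  finally have h: "(h has_sum F y * G y) (?B \<times> ?B)" .
  have "((\<lambda>b. h (e, b)) has_sum ((\<Sum>\<^sub>\<infinity>b\<in>?B. c b * d (\<lambda>i. e i - b i)) * m e)) ?B" if "e \<in> ?B" for e
  proof -
    have "(\<lambda>b. h (e, b)) summable_on ?B"
      using summable_on_SigmaD1[OF _ that, of "\<lambda>e b. h (e, b)" "\<lambda>_. ?B"] h[THEN has_sum_imp_summable] by simp
    then have "(\<lambda>b. c b * d (\<lambda>i. e i - b i) * m e) summable_on ?B"
      by (simp add: h_def)
    from has_sum_infsum[OF this] show ?thesis
      by (simp add: h_def infsum_cmult_left')
  qed
  from has_sum_SigmaD[OF h this]
  show "((\<lambda>e. (\<Sum>\<^sub>\<infinity>b\<in>?B. c b * d (\<lambda>i. e i - b i)) * (\<Prod>i<n. y i powi e i)) has_sum F y * G y) ?B"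
    by (simp add: m_def)
qed

text \<open>Only the existence of coefficients is recorded. The iterated convolutions are never
  evaluated; the coefficients of the affine denominator are found from its symmetries
  instead.\<close>

lemma laurent_prod:
  assumes "finite A" "\<And>a. a \<in> A \<Longrightarrow> \<exists>c. laurent n c (F a)"
  shows "\<exists>c. laurent n c (\<lambda>y. \<Prod>a\<in>A. F a y)"
  using assms
proof (induction A rule: finite_induct)
  case empty
  then show ?case using laurent_const[of n 1] by auto
next
  case (insert a A)
  then obtain c d where "laurent n c (F a)" "laurent n d (\<lambda>y. \<Prod>a\<in>A. F a y)"
    by blast
  from laurent_mult[OF this] show ?case
    using insert.hyps by auto
qed

lemma has_sum_prod_exponents:
  fixes f :: "nat \<Rightarrow> int \<Rightarrow> complex"
  assumes "\<And>i. i < n \<Longrightarrow> (f i has_sum S i) UNIV"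
  shows "((\<lambda>b. \<Prod>i<n. f i (b i)) has_sum (\<Prod>i<n. S i)) (exponents n)"
  using assms
proof (induction n)
  case 0
  have "exponents 0 = {\<lambda>_. 0}" by (auto simp: exponents_def)
  then show ?case by (simp add: has_sum_finite_iff)
next
  case (Suc n)
  have "((\<lambda>(b, a). (\<Prod>i<n. f i (b i)) * f n a) has_sum (\<Prod>i<n. S i) * S n) (exponents n \<times> UNIV)"
    using Suc by (intro has_sum_product) auto
  also have "?this \<longleftrightarrow> ((\<lambda>b. \<Prod>i<Suc n. f i (b i)) has_sum (\<Prod>i<n. S i) * S n) (exponents (Suc n))"
    by (rule has_sum_reindex_bij_witness[where j = "\<lambda>(b, a). b(n := a)" and i = "\<lambda>b. (b(n := 0), b n)"])
       (auto simp: exponents_def fun_eq_iff le_Suc_eq intro!: prod.cong)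
  finally show ?case by simp
qed

subsection \<open>The affine denominator\<close>

text \<open>\<open>U\<close> holds the coefficients of the Newton basis \<open>P j\<close> and is
  upper unitriangular. The entries of \<open>A * U\<close> are the values of \<open>P j\<close> at
  \<open>y i\<close>, which vanish for \<open>i < j\<close>, so the determinant of the power matrix
  \<open>A\<close> is the product of the diagonal of \<open>A * U\<close>.\<close>

lemma vandermonde_leibniz:
  fixes y :: "nat \<Rightarrow> complex"
  shows "(\<Prod>j<n. \<Prod>i<j. y j - y i) = (\<Sum>\<sigma> | \<sigma> permutes {..<n}. of_int (sign \<sigma>) * (\<Prod>i<n. y i ^ \<sigma> i))"
proof -
  define P where "P j = (\<Prod>k<j. [:- y k, 1:])" for j
  define A where "A = Matrix.mat n n (\<lambda>(i, k). y i ^ k)"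
  define U where "U = Matrix.mat n n (\<lambda>(k, j). coeff (P j) k)"
  have deg: "degree (P j) = j" for j
    unfolding P_def by (subst degree_prod_sum_eq) auto
  have lead: "coeff (P j) j = 1" for j
  proof -
    have "lead_coeff (P j) = 1" unfolding P_def lead_coeff_prod by simp
    then show ?thesis by (simp only: deg)
  qed
  have A: "A \<in> carrier_mat n n" and U: "U \<in> carrier_mat n n"
    by (simp_all add: A_def U_def)
  have L: "(A * U) $$ (i, j) = (\<Prod>k<j. y i - y k)" if "i < n" "j < n" for i j
  proof -
    have "(A * U) $$ (i, j) = (\<Sum>k = 0..<n. y i ^ k * coeff (P j) k)"
      using that by (simp add: A_def U_def scalar_prod_def)
    also have "\<dots> = (\<Sum>k\<le>degree (P j). coeff (P j) k * y i ^ k)"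
      using that by (intro sum.mono_neutral_cong_right) (auto simp: deg coeff_eq_0)
    also have "\<dots> = poly (P j) (y i)"
      by (simp add: poly_altdef)
    also have "\<dots> = (\<Prod>k<j. y i - y k)"
      by (simp add: P_def poly_prod)
    finally show ?thesis .
  qed
  have "Determinant.det U = prod_list (diag_mat U)"
    by (rule det_upper_triangular[OF _ U]) (auto simp: U_def deg coeff_eq_0 intro!: upper_triangularI)
  also have "\<dots> = 1"
    by (simp add: prod_list_diag_prod U_def lead)
  finally have "Determinant.det A = Determinant.det (A * U)"
    using det_mult[OF A U] by simp
  also have "\<dots> = prod_list (diag_mat (A * U))"
  proof (rule det_lower_triangular[of n])
    fix i j assume ij: "i < j" "j < n"
    then show "(A * U) $$ (i, j) = 0"
      by (subst L) (auto intro!: prod_zero)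
  qed (use A U in simp)
  also have "\<dots> = (\<Prod>j<n. \<Prod>i<j. y j - y i)"
    unfolding prod_list_diag_prod using A U L by (auto simp: atLeast0LessThan intro!: prod.cong simp del: index_mult_mat(1))
  finally have "Determinant.det A = (\<Prod>j<n. \<Prod>i<j. y j - y i)" .
  moreover have "Determinant.det A = (\<Sum>\<sigma> | \<sigma> permutes {..<n}. of_int (sign \<sigma>) * (\<Prod>i<n. y i ^ \<sigma> i))"
    unfolding det_def'[OF A] atLeast0LessThan
  proof (intro sum.cong refl arg_cong2[where f = "(*)"] prod.cong)
    fix \<sigma> i assume "\<sigma> \<in> {\<sigma>. \<sigma> permutes {..<n}}" "i \<in> {..<n}"
    then have "\<sigma> i < n" "i < n" using permutes_in_image[of \<sigma> "{..<n}" i] by auto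
    then show "A $$ (i, \<sigma> i) = y i ^ \<sigma> i" by (simp add: A_def)
  qed
  ultimately show ?thesis by simp
qed

section \<open>Auxiliary identities for powers, updated sums and roots of unity\<close>

lemma power_int_sum:
  fixes a :: "'a::field"
  assumes "a \<noteq> 0"
  shows "a powi (\<Sum>i\<in>A. f i) = (\<Prod>i\<in>A. a powi f i)"
  using assms by (induction A rule: infinite_finite_induct) (auto simp: power_int_add)

lemma power_int_prod:
  fixes f :: "'b \<Rightarrow> 'a::field"
  shows "(\<Prod>i\<in>A. f i) powi k = (\<Prod>i\<in>A. f i powi k)"
  by (induction A rule: infinite_finite_induct) (auto simp: power_int_mult_distrib)

lemma sum_fun_upd2:
  fixes g :: "nat \<Rightarrow> 'a \<Rightarrow> int"
  assumes "finite A" "i \<in> A" "j \<in> A" "i \<noteq> j"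
  shows "(\<Sum>k\<in>A. g k ((\<beta>(i := a, j := b)) k)) = (\<Sum>k\<in>A. g k (\<beta> k)) + (g i a - g i (\<beta> i)) + (g j b - g j (\<beta> j))"
proof -
  have "(\<Sum>k\<in>A. g k ((\<beta>(i := a, j := b)) k)) =
     (\<Sum>k\<in>A. g k (\<beta> k) + (if k = i then g i a - g i (\<beta> i) else 0) + (if k = j then g j b - g j (\<beta> j) else 0))"
    using assms by (intro sum.cong) auto
  then show ?thesis using assms by (simp add: sum.distrib)
qed

lemma prod_diff_roots_of_unity:
  fixes x :: complex
  assumes n: "n > 0"
  defines "\<omega> \<equiv> cis (2 * pi / real n)"
  shows "(\<Prod>j<n. x - \<omega> ^ j) = x ^ n - 1"
proof -
  have pw: "\<omega> ^ j = cis (2 * pi * real j / real n)" for j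
  proof -
    have "real j * (2 * pi / real n) = 2 * pi * real j / real n" by simp
    then show ?thesis by (simp only: \<omega>_def Complex.DeMoivre)
  qed
  have bij: "bij_betw (\<lambda>j. \<omega> ^ j) {..<n} {z. z ^ n = 1}"
    using Complex.bij_betw_roots_unity[OF n] by (simp only: pw)
  define P where "P = (\<Prod>j<n. [:- (\<omega> ^ j), 1:])"
  have degP: "degree P = n"
    unfolding P_def by (subst degree_prod_sum_eq) auto
  have leadP: "coeff P n = 1"
  proof -
    have "lead_coeff P = 1" unfolding P_def lead_coeff_prod by simp
    then show ?thesis by (simp only: degP)
  qed
  have "P = monom 1 n - 1"
  proof (rule poly_eqI_degree_lead_coeff[where n = n and A = "(\<lambda>j. \<omega> ^ j) ` {..<n}"])
    show "coeff P n = coeff (monom 1 n - 1) n" using n leadP by simp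
    show "degree P \<le> n" by (simp add: degP)
    show "degree (monom 1 n - 1 :: complex poly) \<le> n"
      by (rule degree_diff_le) (auto simp: degree_monom_le)
    show "n \<le> card ((\<lambda>j. \<omega> ^ j) ` {..<n})"
      by (simp only: card_image[OF bij_betw_imp_inj_on[OF bij]] card_lessThan order_refl)
    show "poly P z = poly (monom 1 n - 1) z" if z: "z \<in> (\<lambda>j. \<omega> ^ j) ` {..<n}" for z
    proof -
      have "z ^ n = 1" using z bij by (auto simp: bij_betw_def)
      moreover have "poly P z = 0" using z by (auto simp: P_def poly_prod intro!: prod_zero)
      ultimately show ?thesis by (simp add: poly_monom)
    qed
  qed
  then have "poly P x = x ^ n - 1" by (simp add: poly_monom)
  then show ?thesis by (simp add: P_def poly_prod)
qed

lemma prod_one_minus_roots_of_unity: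
  fixes w :: complex
  assumes n: "n > 0"
  defines "\<omega> \<equiv> cis (2 * pi / real n)"
  shows "(\<Prod>j<n. 1 - w / \<omega> ^ j) = 1 - w ^ n"
proof -
  note roots = prod_diff_roots_of_unity[OF n, folded \<omega>_def]
  have "(\<Prod>j<n. 1 - w / \<omega> ^ j) = (\<Prod>j<n. (w - \<omega> ^ j) / (0 - \<omega> ^ j))"
    by (intro prod.cong) (auto simp: \<omega>_def field_simps)
  also have "\<dots> = (w ^ n - 1) / (0 ^ n - 1)"
    unfolding prod_dividef roots ..
  finally show ?thesis using n by (simp add: zero_power)
qed

lemma prod_offdiag:
  fixes f :: "nat \<Rightarrow> nat \<Rightarrow> 'a::comm_monoid_mult"
  shows "(\<Prod>i<n. \<Prod>j\<in>{..<n} - {i}. f i j) = (\<Prod>j<n. \<Prod>i<j. f i j * f j i)"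
proof (induction n)
  case (Suc n)
  have "(\<Prod>i<n. \<Prod>j\<in>{..<Suc n} - {i}. f i j) = (\<Prod>i<n. f i n * (\<Prod>j\<in>{..<n} - {i}. f i j))"
  proof (intro prod.cong refl)
    fix i assume "i \<in> {..<n}"
    then have "{..<Suc n} - {i} = insert n ({..<n} - {i})" by auto
    then show "(\<Prod>j\<in>{..<Suc n} - {i}. f i j) = f i n * (\<Prod>j\<in>{..<n} - {i}. f i j)" by simp
  qed
  moreover have "{..<Suc n} - {n} = {..<n}" by auto
  ultimately show ?case
    using Suc by (simp add: prod.distrib mult_ac)
qed simp

section \<open>Theta functions and the symmetries of the affine denominator\<close>

definition qtheta :: "complex \<Rightarrow> complex \<Rightarrow> complex" where
  "qtheta p z = qpoch z (p\<^sup>2) * qpoch (p\<^sup>2 / z) (p\<^sup>2)"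

definition affine_den :: "complex \<Rightarrow> nat \<Rightarrow> (nat \<Rightarrow> complex) \<Rightarrow> complex" where
  "affine_den p n y = (\<Prod>j<n. \<Prod>i<j. y j * qtheta p (y i / y j))"

locale nome =
  fixes p :: complex
  assumes p_nz: "p \<noteq> 0" and p_lt: "norm p < 1"
begin

abbreviation "q \<equiv> p\<^sup>2"

lemma q_nz: "q \<noteq> 0" and q_lt: "norm q < 1"
  using p_nz p_lt by (auto simp: norm_power power_less_one_iff)

lemma qtheta_rec: "qtheta p z = (1 - z) * (qpoch (q * z) q * qpoch (q / z) q)"
  unfolding qtheta_def by (subst qpoch_rec[OF q_lt]) (simp add: mult_ac)

text \<open>Dividing the argument by \<open>q\<close> adds the factor \<open>1 - z / q\<close> to
  one product and removes \<open>1 - q / z\<close> from the other; their quotient is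
  \<open>- (z / q)\<close>.\<close>

lemma qtheta_div:
  assumes "z \<noteq> 0"
  shows "qtheta p (z / q) = - (z / q) * qtheta p z"
proof -
  have "qtheta p (z / q) = qpoch (z / q) q * qpoch (q * (q / z)) q"
    by (simp add: qtheta_def power2_eq_square mult_ac)
  also have "qpoch (z / q) q = (1 - z / q) * qpoch z q"
    using q_nz by (subst qpoch_rec[OF q_lt]) simp
  finally have "qtheta p (z / q) = (1 - z / q) * qpoch z q * qpoch (q * (q / z)) q" .
  moreover have "qpoch (q / z) q = (1 - q / z) * qpoch (q * (q / z)) q"
    by (subst qpoch_rec[OF q_lt]) (simp add: mult_ac)
  then have "qtheta p z = (1 - q / z) * (qpoch z q * qpoch (q * (q / z)) q)"
    by (simp only: qtheta_def mult_ac)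
  moreover have "1 - z / q = - (z / q) * (1 - q / z)"
    using assms q_nz by (simp add: field_simps)
  ultimately show ?thesis by (simp only: mult_ac)
qed

text \<open>The factors \<open>y j\<close> turn \<open>1 - y i / y j\<close> into
  \<open>y j - y i\<close>. This isolates the Vandermonde product, which carries the whole
  antisymmetry; the other product runs over all ordered pairs of distinct indices and is
  symmetric.\<close>

lemma affine_den_eq:
  assumes "\<And>i. i < n \<Longrightarrow> y i \<noteq> 0"
  shows "affine_den p n y = (\<Prod>j<n. \<Prod>i<j. y j - y i) * (\<Prod>i<n. \<Prod>j\<in>{..<n} - {i}. qpoch (q * (y i / y j)) q)"
proof -
  have "affine_den p n y = (\<Prod>j<n. \<Prod>i<j. (y j - y i) * (qpoch (q * (y i / y j)) q * qpoch (q * (y j / y i)) q))"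
    unfolding affine_den_def
  proof (intro prod.cong refl)
    fix j i assume "j \<in> {..<n}" "i \<in> {..<j}"
    then have "y i \<noteq> 0" "y j \<noteq> 0" using assms by auto
    then show "y j * qtheta p (y i / y j) = (y j - y i) * (qpoch (q * (y i / y j)) q * qpoch (q * (y j / y i)) q)"
      by (subst qtheta_rec) (simp add: field_simps)
  qed
  then show ?thesis
    unfolding prod_offdiag by (simp only: prod.distrib)
qed

text \<open>The sign comes from the Leibniz expansion of the Vandermonde product, where the
  summation variable is composed with \<open>\<tau>\<close>; the symmetric product is merely
  reindexed.\<close>

lemma affine_den_permute:
  assumes \<tau>: "\<tau> permutes {..<n}" and y: "\<And>i. i < n \<Longrightarrow> y i \<noteq> 0"
  shows "affine_den p n (y \<circ> \<tau>) = of_int (sign \<tau>) * affine_den p n y"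
proof -
  have bij: "bij_betw \<tau> {..<n} {..<n}"
    using \<tau> by (rule permutes_imp_bij)
  have y': "(y \<circ> \<tau>) i \<noteq> 0" if "i < n" for i
    using y that permutes_in_image[OF \<tau>, of i] by auto
  have "(\<Prod>j<n. \<Prod>i<j. (y \<circ> \<tau>) j - (y \<circ> \<tau>) i) =
      (\<Sum>\<sigma> | \<sigma> permutes {..<n}. of_int (sign (\<sigma> \<circ> \<tau>)) * (\<Prod>i<n. y (\<tau> i) ^ \<sigma> (\<tau> i)))"
    unfolding vandermonde_leibniz by (subst sum_permutations_compose_right[OF \<tau>]) simp
  also have "\<dots> = (\<Sum>\<sigma> | \<sigma> permutes {..<n}. of_int (sign \<tau>) * (of_int (sign \<sigma>) * (\<Prod>i<n. y i ^ \<sigma> i)))"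
  proof (rule sum.cong[OF refl])
    fix \<sigma> assume "\<sigma> \<in> {\<sigma>. \<sigma> permutes {..<n}}"
    then have "sign (\<sigma> \<circ> \<tau>) = sign \<sigma> * sign \<tau>"
      using \<tau> by (intro sign_compose permutes_imp_permutation[where S = "{..<n}"]) auto
    moreover have "(\<Prod>i<n. y (\<tau> i) ^ \<sigma> (\<tau> i)) = (\<Prod>i<n. y i ^ \<sigma> i)"
      by (rule prod.reindex_bij_betw[OF bij])
    ultimately show "of_int (sign (\<sigma> \<circ> \<tau>)) * (\<Prod>i<n. y (\<tau> i) ^ \<sigma> (\<tau> i)) =
        of_int (sign \<tau>) * (of_int (sign \<sigma>) * (\<Prod>i<n. y i ^ \<sigma> i))"
      by simp
  qed
  finally have V: "(\<Prod>j<n. \<Prod>i<j. (y \<circ> \<tau>) j - (y \<circ> \<tau>) i) = of_int (sign \<tau>) * (\<Prod>j<n. \<Prod>i<j. y j - y i)"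
    unfolding vandermonde_leibniz by (simp add: sum_distrib_left)
  have "(\<Prod>i<n. \<Prod>j\<in>{..<n} - {i}. qpoch (q * ((y \<circ> \<tau>) i / (y \<circ> \<tau>) j)) q)
      = (\<Prod>i<n. \<Prod>j\<in>{..<n} - {\<tau> i}. qpoch (q * (y (\<tau> i) / y j)) q)"
  proof (rule prod.cong[OF refl])
    fix i assume i: "i \<in> {..<n}"
    have "bij_betw \<tau> ({..<n} - {i}) ({..<n} - {\<tau> i})"
      using bij_betw_DiffI[OF bij, of "{i}" "{\<tau> i}"] i permutes_in_image[OF \<tau>] by (auto simp: bij_betw_def)
    from prod.reindex_bij_betw[OF this]
    show "(\<Prod>j\<in>{..<n} - {i}. qpoch (q * ((y \<circ> \<tau>) i / (y \<circ> \<tau>) j)) q) =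
       (\<Prod>j\<in>{..<n} - {\<tau> i}. qpoch (q * (y (\<tau> i) / y j)) q)"
      by simp
  qed
  also have "\<dots> = (\<Prod>i<n. \<Prod>j\<in>{..<n} - {i}. qpoch (q * (y i / y j)) q)"
    by (rule prod.reindex_bij_betw[OF bij])
  finally have Q: "(\<Prod>i<n. \<Prod>j\<in>{..<n} - {i}. qpoch (q * ((y \<circ> \<tau>) i / (y \<circ> \<tau>) j)) q)
      = (\<Prod>i<n. \<Prod>j\<in>{..<n} - {i}. qpoch (q * (y i / y j)) q)" .
  show ?thesis
    by (subst affine_den_eq[OF y'], assumption, subst affine_den_eq[OF y], assumption)
       (simp only: Q V mult.assoc)
qed

lemma affine_den_scale:
  assumes "a \<noteq> 0"
  shows "affine_den p n (\<lambda>i. a * y i) = a ^ (\<Sum>j<n. j) * affine_den p n y"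
  using assms by (simp add: affine_den_def prod.distrib power_sum mult_ac)

text \<open>The last variable occurs in the factors with largest index only, and always as the
  denominator of the theta argument, so \<open>qtheta_div\<close> applies to each and contributes
  \<open>- (y i / y n)\<close>. The other variables are reached later through antisymmetry.\<close>

lemma affine_den_shift_last:
  assumes y: "\<And>i. i \<le> n \<Longrightarrow> y i \<noteq> 0"
  shows "affine_den p (Suc n) (y(n := q * y n)) = (- 1) ^ n * (\<Prod>i<n. y i / y n) * affine_den p (Suc n) y"
proof -
  have "(\<Prod>i<n. q * y n * qtheta p (y i / (q * y n))) = (\<Prod>i<n. - (y i / y n) * (y n * qtheta p (y i / y n)))"
  proof (intro prod.cong refl)
    fix i assume "i \<in> {..<n}"
    then have "y i / y n \<noteq> 0" using y by auto
    from qtheta_div[OF this] show "q * y n * qtheta p (y i / (q * y n)) = - (y i / y n) * (y n * qtheta p (y i / y n))"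
      using q_nz by (simp add: field_simps)
  qed
  also have "\<dots> = (- 1) ^ n * (\<Prod>i<n. y i / y n) * (\<Prod>i<n. y n * qtheta p (y i / y n))"
    by (simp only: prod.distrib prod_uminus card_lessThan)
  finally have last: "(\<Prod>i<n. q * y n * qtheta p (y i / (q * y n))) =
     (- 1) ^ n * (\<Prod>i<n. y i / y n) * (\<Prod>i<n. y n * qtheta p (y i / y n))" .
  let ?z = "y(n := q * y n)"
  have "affine_den p (Suc n) ?z = affine_den p n ?z * (\<Prod>i<n. ?z n * qtheta p (?z i / ?z n))"
    by (simp add: affine_den_def)
  also have "affine_den p n ?z = affine_den p n y"
    unfolding affine_den_def by (intro prod.cong refl) auto
  also have "(\<Prod>i<n. ?z n * qtheta p (?z i / ?z n)) = (\<Prod>i<n. q * y n * qtheta p (y i / (q * y n)))"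
    by (intro prod.cong refl) auto
  also have "affine_den p n y * \<dots> = (- 1) ^ n * (\<Prod>i<n. y i / y n) * (affine_den p n y * (\<Prod>i<n. y n * qtheta p (y i / y n)))"
    unfolding last by (simp only: mult_ac)
  also have "affine_den p n y * (\<Prod>i<n. y n * qtheta p (y i / y n)) = affine_den p (Suc n) y"
    by (simp add: affine_den_def)
  finally show ?thesis .
qed

lemma laurent_qtheta:
  assumes "i < j" "j < n"
  shows "\<exists>c. laurent n c (\<lambda>y. y j * qtheta p (y i / y j))"
proof -
  \<comment> \<open>These are the triple product coefficients at argument \<open>z / p\<close>,
    where the two infinite products become those of \<open>qtheta p z\<close>; the extra
    \<open>- k\<close> in the exponent comes from the division by \<open>p\<close>.\<close>
  define t where "t k = inverse (qpoch q q) * ((-1) powi k * p powi (k\<^sup>2 - k))" for k :: int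
  \<comment> \<open>\<open>e k\<close> is the exponent vector of the monomial
    \<open>y j * (y i / y j) powi k\<close>.\<close>
  define e where "e k = (\<lambda>l. if l = i then k else if l = j then 1 - k else 0)" for k :: int
  have inj: "inj e" by (rule injI) (metis e_def)
  have sub: "range e \<subseteq> exponents n" using assms by (auto simp: e_def exponents_def)
  define c where "c b = (if b \<in> range e then t (inv_into UNIV e b) else 0)" for b
  have "laurent n c (\<lambda>y. y j * qtheta p (y i / y j))"
    unfolding laurent_def
  proof (intro allI impI)
    fix y :: "nat \<Rightarrow> complex" assume "\<forall>i<n. y i \<noteq> 0"
    then have y: "y i \<noteq> 0" "y j \<noteq> 0" using assms by auto
    define z where "z = y i / y j"
    have z: "z \<noteq> 0" using y by (simp add: z_def)
    have "((\<lambda>k. (-1) powi k * p powi (k\<^sup>2) * (z / p) powi k) has_sum (qpoch q q * qpoch (p * (z / p)) q * qpoch (p / (z / p)) q)) UNIV"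
      using z p_nz by (intro jacobi_triple_product p_nz p_lt) auto
    from has_sum_cmult_right[OF this, of "y j * inverse (qpoch q q)"]
    have "((\<lambda>k. y j * inverse (qpoch q q) * ((-1) powi k * p powi (k\<^sup>2) * (z / p) powi k)) has_sum (y j * qtheta p z)) UNIV"
    proof (rule back_subst[where P = "\<lambda>S. (_ has_sum S) UNIV"])
      have "p * (z / p) = z" "p / (z / p) = q / z"
        using p_nz by (simp_all add: power2_eq_square)
      then show "y j * inverse (qpoch q q) * (qpoch q q * qpoch (p * (z / p)) q * qpoch (p / (z / p)) q) = y j * qtheta p z"
        using qpoch_self_nonzero[OF q_lt] by (simp only: qtheta_def) (simp add: field_simps)
    qed
    also have "(\<lambda>k. y j * inverse (qpoch q q) * ((-1) powi k * p powi (k\<^sup>2) * (z / p) powi k)) = (\<lambda>k. t k * (z powi k * y j))"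
      using p_nz by (simp add: fun_eq_iff t_def power_int_divide_distrib power_int_diff)
    finally have "((\<lambda>k. t k * (z powi k * y j)) has_sum (y j * qtheta p z)) UNIV" .
    moreover have "(\<Prod>l<n. y l powi e k l) = z powi k * y j" for k
    proof -
      have "(\<Prod>l<n. y l powi e k l) = (\<Prod>l\<in>{i, j}. y l powi e k l)"
        using assms by (intro prod.mono_neutral_right) (auto simp: e_def)
      then show ?thesis
        using assms y by (simp add: e_def z_def power_int_divide_distrib power_int_diff)
    qed
    ultimately have "((\<lambda>k. c (e k) * (\<Prod>l<n. y l powi e k l)) has_sum (y j * qtheta p z)) UNIV"
      using inj by (simp add: c_def)
    then have "((\<lambda>b. c b * (\<Prod>l<n. y l powi b l)) has_sum (y j * qtheta p z)) (range e)"
      using has_sum_reindex[OF inj, of "\<lambda>b. c b * (\<Prod>l<n. y l powi b l)"] by (simp add: o_def)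
    then show "((\<lambda>b. c b * (\<Prod>l<n. y l powi b l)) has_sum (y j * qtheta p (y i / y j))) (exponents n)"
      unfolding z_def
      by (rule has_sum_cong_neutral[THEN iffD1, rotated -1]) (use sub in \<open>auto simp: c_def\<close>)
  qed
  then show ?thesis by blast
qed

lemma laurent_affine_den_ex: "\<exists>c. laurent n c (affine_den p n)"
proof -
  have "\<exists>c. laurent n c (\<lambda>y. \<Prod>j<n. \<Prod>i<j. y j * qtheta p (y i / y j))"
    by (intro laurent_prod laurent_qtheta) auto
  then show ?thesis by (simp add: affine_den_def[abs_def])
qed

text \<open>The choice is harmless: \<open>laurent_unique\<close> determines the values on
  \<open>exponents n\<close>. Symmetries of the coefficients are then read off by expanding one
  function in two ways.\<close>

definition den_coeff :: "nat \<Rightarrow> (nat \<Rightarrow> int) \<Rightarrow> complex" where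
  "den_coeff n = (SOME c. laurent n c (affine_den p n))"

lemma laurent_affine_den: "laurent n (den_coeff n) (affine_den p n)"
  unfolding den_coeff_def using laurent_affine_den_ex by (rule someI_ex)

text \<open>Both sides are the coefficients of one function: the permuted affine denominator
  expanded directly, with exponents reindexed, and expanded through
  \<open>affine_den_permute\<close>.\<close>

lemma den_coeff_permute:
  assumes \<tau>: "\<tau> permutes {..<n}" and c: "c \<in> exponents n"
  shows "den_coeff n (c \<circ> \<tau>) = of_int (sign \<tau>) * den_coeff n c"
proof (rule laurent_unique[OF _ _ c])
  have bij: "bij_betw \<tau> {..<n} {..<n}"
    using \<tau> by (rule permutes_imp_bij)
  have fix_ge: "\<sigma> i = i" if "\<sigma> permutes {..<n}" "i \<ge> n" for \<sigma> i
    using that by (auto simp: permutes_def)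
  show "laurent n (\<lambda>c. den_coeff n (c \<circ> \<tau>)) (\<lambda>y. of_int (sign \<tau>) * affine_den p n y)"
    unfolding laurent_def
  proof (intro allI impI)
    fix y :: "nat \<Rightarrow> complex" assume y: "\<forall>i<n. y i \<noteq> 0"
    have y': "(y \<circ> \<tau>) i \<noteq> 0" if "i < n" for i
      using y that permutes_in_image[OF \<tau>, of i] by auto
    have "((\<lambda>b. den_coeff n b * (\<Prod>i<n. (y \<circ> \<tau>) i powi b i)) has_sum affine_den p n (y \<circ> \<tau>)) (exponents n)"
      by (intro laurentD laurent_affine_den y')
    also have "affine_den p n (y \<circ> \<tau>) = of_int (sign \<tau>) * affine_den p n y"
      using y by (intro affine_den_permute \<tau>) auto
    finally have *: "((\<lambda>b. den_coeff n b * (\<Prod>i<n. y (\<tau> i) powi b i)) has_sum of_int (sign \<tau>) * affine_den p n y) (exponents n)"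
      by simp
    have "bij_betw (\<lambda>c. c \<circ> \<tau>) (exponents n) (exponents n)"
      by (rule bij_betwI[where g = "\<lambda>c. c \<circ> inv_into UNIV \<tau>"])
         (auto simp: exponents_def fix_ge \<tau> permutes_inv fun_eq_iff permutes_inverses[OF \<tau>])
    from has_sum_reindex_bij_betw[OF this, THEN iffD2, OF *]
    have "((\<lambda>c. den_coeff n (c \<circ> \<tau>) * (\<Prod>i<n. y (\<tau> i) powi c (\<tau> i))) has_sum of_int (sign \<tau>) * affine_den p n y) (exponents n)"
      by simp
    then show "((\<lambda>c. den_coeff n (c \<circ> \<tau>) * (\<Prod>i<n. y i powi c i)) has_sum of_int (sign \<tau>) * affine_den p n y) (exponents n)"
      by (subst (asm) prod.reindex_bij_betw[OF bij, of "\<lambda>i. y i powi _ i"])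
  qed
  show "laurent n (\<lambda>c. of_int (sign \<tau>) * den_coeff n c) (\<lambda>y. of_int (sign \<tau>) * affine_den p n y)"
    by (intro laurent_cmult laurent_affine_den)
qed

text \<open>It suffices to compare the coefficients of $A(2y)$ and $A(y)$.\<close>

lemma den_coeff_homogeneous:
  assumes c: "c \<in> exponents n" and nz: "den_coeff n c \<noteq> 0"
  shows "(\<Sum>i<n. c i) = (\<Sum>i<n. int i)"
proof -
  have "den_coeff n c * 2 powi (\<Sum>i<n. c i) = 2 ^ (\<Sum>i<n. i) * den_coeff n c"
  proof (rule laurent_unique[OF _ _ c])
    show "laurent n (\<lambda>c. den_coeff n c * 2 powi (\<Sum>i<n. c i)) (\<lambda>y. 2 ^ (\<Sum>i<n. i) * affine_den p n y)"
      unfolding laurent_def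
    proof (intro allI impI)
      fix y :: "nat \<Rightarrow> complex" assume y: "\<forall>i<n. y i \<noteq> 0"
      then have "((\<lambda>b. den_coeff n b * (\<Prod>i<n. (2 * y i) powi b i)) has_sum affine_den p n (\<lambda>i. 2 * y i)) (exponents n)"
        by (intro laurentD laurent_affine_den) auto
      also have "affine_den p n (\<lambda>i. 2 * y i) = 2 ^ (\<Sum>i<n. i) * affine_den p n y"
        by (rule affine_den_scale) simp
      also have "(\<lambda>b. den_coeff n b * (\<Prod>i<n. (2 * y i) powi b i)) = (\<lambda>b. den_coeff n b * 2 powi (\<Sum>i<n. b i) * (\<Prod>i<n. y i powi b i))"
        by (simp add: power_int_mult_distrib prod.distrib power_int_sum mult.assoc)
      finally show "((\<lambda>b. den_coeff n b * 2 powi (\<Sum>i<n. b i) * (\<Prod>i<n. y i powi b i)) has_sum 2 ^ (\<Sum>i<n. i) * affine_den p n y) (exponents n)" .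
    qed
    show "laurent n (\<lambda>c. 2 ^ (\<Sum>i<n. i) * den_coeff n c) (\<lambda>y. 2 ^ (\<Sum>i<n. i) * affine_den p n y)"
      by (intro laurent_cmult laurent_affine_den)
  qed
  with nz have "(2::complex) powi (\<Sum>i<n. c i) = 2 powi int (\<Sum>i<n. i)"
    by (simp only: power_int_of_nat) simp
  \<comment> \<open>Exponents of 2 can be compared once the equation is real, by strict
    monotonicity.\<close>
  then have "of_real (2 powi (\<Sum>i<n. c i)) = (of_real (2 powi int (\<Sum>i<n. i)) :: complex)"
    by (simp add: of_real_power_int)
  then have "(2::real) powi (\<Sum>i<n. c i) = 2 powi int (\<Sum>i<n. i)"
    by (simp only: of_real_eq_iff)
  then have "(\<Sum>i<n. c i) = int (\<Sum>i<n. i)"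
    using power_int_strict_increasing[of "\<Sum>i<n. c i" "int (\<Sum>i<n. i)" "2::real"]
      power_int_strict_increasing[of "int (\<Sum>i<n. i)" "\<Sum>i<n. c i" "2::real"]
    by (metis less_irrefl linorder_neqE one_less_numeral_iff semiring_norm(76))
  then show ?thesis by simp
qed

subsection \<open>Laurent coefficients of the affine denominator\<close>

text \<open>Subtracts the exponent vector of the product of all \<open>y k\<close> divided by
  \<open>y i ^ n\<close>, which is up to sign the multiplier of the affine denominator when
  \<open>y i\<close> is replaced by \<open>q * y i\<close>.\<close>

definition den_shift :: "nat \<Rightarrow> nat \<Rightarrow> (nat \<Rightarrow> int) \<Rightarrow> nat \<Rightarrow> int" where
  "den_shift n i c = (\<lambda>k. if k < n then c k - 1 + (if k = i then int n else 0) else 0)"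

text \<open>Replacing \<open>y m\<close> by \<open>q * y m\<close> weights the coefficient at
  \<open>c\<close> by \<open>q powi (c m)\<close>; by quasi-periodicity it also multiplies the
  function by a signed monomial with exponent \<open>v\<close>, which translates the
  coefficients.\<close>

lemma den_coeff_shift_last:
  assumes c: "c \<in> exponents (Suc m)"
  shows "den_coeff (Suc m) (den_shift (Suc m) m c) = (-1) ^ m * q powi (c m) * den_coeff (Suc m) c"
proof -
  define v where "v = (\<lambda>k. if k < m then 1 else if k = m then - int m else 0)"
  have v: "v \<in> exponents (Suc m)" by (auto simp: v_def exponents_def)
  let ?F = "\<lambda>y. affine_den p (Suc m) (y(m := q * y m))"
  have "den_coeff (Suc m) c * q powi (c m) = (-1) ^ m * den_coeff (Suc m) (\<lambda>k. c k - v k)"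
  proof (rule laurent_unique[OF _ _ c])
    show "laurent (Suc m) (\<lambda>c. den_coeff (Suc m) c * q powi (c m)) ?F"
      unfolding laurent_def
    proof (intro allI impI)
      fix y :: "nat \<Rightarrow> complex" assume y: "\<forall>i<Suc m. y i \<noteq> 0"
      have "((\<lambda>b. den_coeff (Suc m) b * (\<Prod>i<Suc m. (y(m := q * y m)) i powi b i)) has_sum ?F y) (exponents (Suc m))"
        by (rule laurentD[OF laurent_affine_den]) (use y q_nz in auto)
      moreover have "(\<Prod>i<Suc m. (y(m := q * y m)) i powi b i) = q powi (b m) * (\<Prod>i<Suc m. y i powi b i)" for b
        by (simp add: power_int_mult_distrib)
      ultimately show "((\<lambda>b. den_coeff (Suc m) b * q powi (b m) * (\<Prod>i<Suc m. y i powi b i)) has_sum ?F y) (exponents (Suc m))"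
        by (simp only: mult.assoc)
    qed
    have "laurent (Suc m) (\<lambda>c. (-1) ^ m * den_coeff (Suc m) (\<lambda>k. c k - v k))
       (\<lambda>y. (-1) ^ m * ((\<Prod>i<Suc m. y i powi v i) * affine_den p (Suc m) y))"
      by (intro laurent_cmult laurent_monom_mult laurent_affine_den v)
    then show "laurent (Suc m) (\<lambda>c. (-1) ^ m * den_coeff (Suc m) (\<lambda>k. c k - v k)) ?F"
    proof (rule laurent_cong)
      fix y :: "nat \<Rightarrow> complex" assume y: "\<And>i. i < Suc m \<Longrightarrow> y i \<noteq> 0"
      have "(\<Prod>i<Suc m. y i powi v i) = (\<Prod>i<m. y i / y m)"
        by (simp add: v_def power_int_minus divide_inverse prod.distrib power_inverse)
      moreover have "?F y = (-1) ^ m * (\<Prod>i<m. y i / y m) * affine_den p (Suc m) y"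
        by (rule affine_den_shift_last) (use y in auto)
      ultimately show "(-1) ^ m * ((\<Prod>i<Suc m. y i powi v i) * affine_den p (Suc m) y) = ?F y"
        by simp
    qed
  qed
  moreover have "(\<lambda>k. c k - v k) = den_shift (Suc m) m c"
    using c by (auto simp: fun_eq_iff v_def den_shift_def exponents_def)
  ultimately show ?thesis by (simp add: mult_ac)
qed

text \<open>Conjugation with the transposition of \<open>i\<close> and the last index reduces to the
  last variable; the sign of the transposition enters on both sides and cancels.\<close>

lemma den_coeff_shift:
  assumes c: "c \<in> exponents n" and i: "i < n"
  shows "den_coeff n (den_shift n i c) = (-1) ^ (n - 1) * q powi (c i) * den_coeff n c"
proof -
  obtain m where n: "n = Suc m" using i by (cases n) auto
  define \<tau> where "\<tau> = Transposition.transpose i m"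
  have \<tau>: "\<tau> permutes {..<n}"
    unfolding \<tau>_def using i n by (intro permutes_swap_id) auto
  have c\<tau>: "c \<circ> \<tau> \<in> exponents n"
    using c i n by (auto simp: exponents_def \<tau>_def Transposition.transpose_def)
  have s: "den_shift n i c \<in> exponents n" by (auto simp: den_shift_def exponents_def)
  have "den_shift n i c \<circ> \<tau> = den_shift n m (c \<circ> \<tau>)"
    using i n by (auto simp: fun_eq_iff den_shift_def \<tau>_def Transposition.transpose_def)
  then have "of_int (sign \<tau>) * den_coeff n (den_shift n i c) = (-1) ^ m * q powi (c i) * (of_int (sign \<tau>) * den_coeff n c)"
    using den_coeff_shift_last[of "c \<circ> \<tau>" m] c\<tau> den_coeff_permute[OF \<tau> s] den_coeff_permute[OF \<tau> c] n
    by (simp add: \<tau>_def)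
  then show ?thesis using n by (cases \<tau> rule: sign_cases) auto
qed

text \<open>The shifts of one vector \<open>c\<close> at \<open>i\<close> and at \<open>j\<close>
  differ by n (e_i - e_j). With \<open>c\<close> chosen so that its shift at \<open>j\<close> is
  \<open>d\<close>, the signs cancel and the quotient of the two powers of \<open>q\<close>
  remains.\<close>

lemma den_coeff_translate_Suc:
  assumes d: "d \<in> exponents n" and ij: "i < n" "j < n" "i \<noteq> j"
  shows "den_coeff n (d(i := d i + int n, j := d j - int n)) = q powi (d i - d j + int n) * den_coeff n d"
proof -
  define c where "c = (\<lambda>k. if k < n then d k + 1 - (if k = j then int n else 0) else 0)"
  have c: "c \<in> exponents n" by (auto simp: c_def exponents_def)
  have "den_shift n j c = d"
    using d ij by (auto simp: fun_eq_iff den_shift_def c_def exponents_def)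
  moreover have "den_shift n i c = d(i := d i + int n, j := d j - int n)"
    using d ij by (auto simp: fun_eq_iff den_shift_def c_def exponents_def)
  moreover have "c i = d i + 1" "c j = d j + 1 - int n" using ij by (auto simp: c_def)
  ultimately have *: "den_coeff n (d(i := d i + int n, j := d j - int n)) = (-1) ^ (n - 1) * q powi (d i + 1) * den_coeff n c"
      "den_coeff n d = (-1) ^ (n - 1) * q powi (d j + 1 - int n) * den_coeff n c"
    using den_coeff_shift[OF c ij(1)] den_coeff_shift[OF c ij(2)] by simp_all
  have "q powi (d i + 1) = q powi (d i - d j + int n) * q powi (d j + 1 - int n)"
    using q_nz by (simp add: power_int_add[symmetric])
  then show ?thesis unfolding * by simp
qed

lemma q_powi: "q powi k = p powi (2 * k)"
  by (simp add: power_int_mult)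

text \<open>Iterating the single step sums an arithmetic progression, whence the term quadratic in
  \<open>l\<close>. Negative \<open>l\<close> are covered by exchanging \<open>i\<close> and
  \<open>j\<close>.\<close>

lemma den_coeff_translate:
  assumes d: "d \<in> exponents n" and ij: "i < n" "j < n" "i \<noteq> j"
  shows "den_coeff n (d(i := d i + int n * l, j := d j - int n * l)) =
     p powi (2 * l * (d i - d j) + 2 * int n * l\<^sup>2) * den_coeff n d"
proof -
  have nonneg: "den_coeff n (d(i := d i + int n * int l, j := d j - int n * int l)) =
     p powi (2 * int l * (d i - d j) + 2 * int n * (int l)\<^sup>2) * den_coeff n d"
    if ij: "i < n" "j < n" "i \<noteq> j" for i j l
  proof (induction l)
    case (Suc l)
    define d' where "d' = d(i := d i + int n * int l, j := d j - int n * int l)"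
    have d': "d' \<in> exponents n" using d ij by (auto simp: d'_def exponents_def)
    have "d'(i := d' i + int n, j := d' j - int n) = d(i := d i + int n * int (Suc l), j := d j - int n * int (Suc l))"
      using ij by (auto simp: d'_def fun_eq_iff algebra_simps)
    then have "den_coeff n (d(i := d i + int n * int (Suc l), j := d j - int n * int (Suc l))) =
       q powi (d' i - d' j + int n) * den_coeff n d'"
      using den_coeff_translate_Suc[OF d' ij] by simp
    also have "d' i - d' j = d i - d j + 2 * int n * int l"
      using ij by (simp add: d'_def)
    also have "den_coeff n d' = p powi (2 * int l * (d i - d j) + 2 * int n * (int l)\<^sup>2) * den_coeff n d"
      using Suc unfolding d'_def .
    also have "q powi (d i - d j + 2 * int n * int l + int n) * (p powi (2 * int l * (d i - d j) + 2 * int n * (int l)\<^sup>2) * den_coeff n d)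
      = p powi (2 * int (Suc l) * (d i - d j) + 2 * int n * (int (Suc l))\<^sup>2) * den_coeff n d"
      using p_nz unfolding q_powi mult.assoc[symmetric]
      by (simp add: power_int_add[symmetric] algebra_simps power2_eq_square)
    finally show ?case .
  qed simp
  show ?thesis
  proof (cases "l \<ge> 0")
    case True
    then show ?thesis using nonneg[OF ij, of "nat l"] by simp
  next
    case False
    have "d(i := d i + int n * l, j := d j - int n * l) = d(j := d j + int n * (- l), i := d i - int n * (- l))"
      using ij by (auto simp: fun_eq_iff)
    moreover have "2 * (- l) * (d j - d i) + 2 * int n * (- l)\<^sup>2 = 2 * l * (d i - d j) + 2 * int n * l\<^sup>2"
      by (simp add: algebra_simps)
    moreover have "int (nat (- l)) = - l" using False by simp
    ultimately show ?thesis
      using nonneg[OF ij(2,1) ij(3)[symmetric], of "nat (- l)"] by (simp only:)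
  qed
qed

lemma den_coeff_swap:
  assumes c: "c \<in> exponents n" and ij: "i < n" "j < n" "i \<noteq> j"
  shows "den_coeff n (c(i := c j, j := c i)) = - den_coeff n c"
proof -
  define \<tau> where "\<tau> = Transposition.transpose i j"
  have \<tau>: "\<tau> permutes {..<n}"
    unfolding \<tau>_def using ij by (intro permutes_swap_id) auto
  have "c(i := c j, j := c i) = c \<circ> \<tau>"
    using ij by (auto simp: fun_eq_iff \<tau>_def Transposition.transpose_def)
  moreover have "sign \<tau> = - 1"
    using ij by (simp add: \<tau>_def sign_swap_id)
  ultimately show ?thesis
    using den_coeff_permute[OF \<tau> c] by simp
qed

text \<open>Translating by a multiple of \<open>n (e_i - e_j)\<close> can be made to have the same effect as exchanging
  \<open>c i\<close> and \<open>c j\<close>; the former fixes the coefficient, the latter negates it.\<close>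

lemma den_coeff_eq_0:
  assumes c: "c \<in> exponents n" and ij: "i < n" "j < n" "i \<noteq> j" and cong: "c i mod int n = c j mod int n"
  shows "den_coeff n c = 0"
proof -
  obtain l where l: "c j - c i = int n * l"
    using cong by (metis mod_eq_dvd_iff dvd_def)
  have "c(i := c i + int n * l, j := c j - int n * l) = c(i := c j, j := c i)"
    using l by (auto simp: fun_eq_iff)
  moreover have "2 * l * (c i - c j) + 2 * int n * l\<^sup>2 = 0"
  proof -
    have "c i - c j = - (int n * l)" using l by simp
    then show ?thesis by (simp add: power2_eq_square)
  qed
  ultimately have "- den_coeff n c = den_coeff n c"
    using den_coeff_translate[OF c ij, of l] den_coeff_swap[OF c ij] by simp
  then show ?thesis by simp
qed

definition den_base :: "nat \<Rightarrow> complex" where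
  "den_base n = den_coeff n (\<lambda>i. if i < n then int i else 0)"

text \<open>Induction on the sum of the absolute values: a nonzero vector of sum 0 has a positive
  and a negative entry, and moving one unit between them lowers that sum by 2. The power of
  \<open>q\<close> picked up in \<open>den_coeff_translate_Suc\<close> is exactly the increment of
  the quadratic form in the exponent.\<close>

lemma den_coeff_lattice:
  assumes "\<beta> \<in> exponents n" and "(\<Sum>i<n. \<beta> i) = 0"
  shows "den_coeff n (\<lambda>i. if i < n then int i + int n * \<beta> i else 0) =
     den_base n * p powi (\<Sum>i<n. int n * (\<beta> i)\<^sup>2 + 2 * int i * \<beta> i)"
  using assms
proof (induction "nat (\<Sum>i<n. \<bar>\<beta> i\<bar>)" arbitrary: \<beta> rule: less_induct)
  case less
  show ?case
  proof (cases "\<forall>i<n. \<beta> i = 0")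
    case True
    then have "(\<lambda>i. if i < n then int i + int n * \<beta> i else 0) = (\<lambda>i. if i < n then int i else 0)"
      by auto
    then show ?thesis using True by (simp add: den_base_def)
  next
    case False
    have "\<exists>i<n. \<beta> i > 0"
    proof (rule ccontr)
      assume "\<not> ?thesis"
      then have "\<And>i. i \<in> {..<n} \<Longrightarrow> \<beta> i \<le> 0" by auto
      with less.prems(2) have "\<forall>i\<in>{..<n}. \<beta> i = 0"
        using sum_nonneg_eq_0_iff[of "{..<n}" "\<lambda>i. - \<beta> i"] by (simp add: sum_negf)
      then show False using False by auto
    qed
    then obtain i where i: "i < n" "\<beta> i > 0" by blast
    have "\<exists>i<n. \<beta> i < 0"
    proof (rule ccontr)
      assume "\<not> ?thesis"
      then have "\<And>i. i \<in> {..<n} \<Longrightarrow> \<beta> i \<ge> 0" by auto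
      with less.prems(2) have "\<forall>i\<in>{..<n}. \<beta> i = 0"
        by (subst (asm) sum_nonneg_eq_0_iff) auto
      then show False using False by auto
    qed
    then obtain j where j: "j < n" "\<beta> j < 0" by blast
    have ij: "i \<noteq> j" using i j by auto
    define \<gamma> where "\<gamma> = \<beta>(i := \<beta> i - 1, j := \<beta> j + 1)"
    note upd = sum_fun_upd2[where A = "{..<n}" and i = i and j = j and \<beta> = \<beta> and a = "\<beta> i - 1" and b = "\<beta> j + 1", folded \<gamma>_def]
    have \<gamma>: "\<gamma> \<in> exponents n" using less.prems i j by (auto simp: \<gamma>_def exponents_def)
    have \<gamma>0: "(\<Sum>k<n. \<gamma> k) = 0"
      using upd[of "\<lambda>_ x. x"] i j ij less.prems by simp
    have dec: "(\<Sum>k<n. \<bar>\<gamma> k\<bar>) = (\<Sum>k<n. \<bar>\<beta> k\<bar>) - 2"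
      using upd[of "\<lambda>_ x. \<bar>x\<bar>"] i j ij by simp
    moreover have "0 \<le> (\<Sum>k<n. \<bar>\<gamma> k\<bar>)" by (intro sum_nonneg) auto
    ultimately have "nat (\<Sum>k<n. \<bar>\<gamma> k\<bar>) < nat (\<Sum>k<n. \<bar>\<beta> k\<bar>)" by simp
    from less.hyps[OF this \<gamma> \<gamma>0]
    have IH: "den_coeff n (\<lambda>i. if i < n then int i + int n * \<gamma> i else 0) =
     den_base n * p powi (\<Sum>i<n. int n * (\<gamma> i)\<^sup>2 + 2 * int i * \<gamma> i)" .
    define d where "d = (\<lambda>i. if i < n then int i + int n * \<gamma> i else 0)"
    have d: "d \<in> exponents n" by (auto simp: d_def exponents_def)
    have "(\<lambda>i. if i < n then int i + int n * \<beta> i else 0) = d(i := d i + int n, j := d j - int n)"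
      using i j ij by (auto simp: fun_eq_iff d_def \<gamma>_def algebra_simps)
    then have "den_coeff n (\<lambda>i. if i < n then int i + int n * \<beta> i else 0) = q powi (d i - d j + int n) * den_coeff n d"
      using den_coeff_translate_Suc[OF d i(1) j(1) ij] by simp
    also have "\<dots> = den_base n * (p powi (2 * (d i - d j + int n)) * p powi (\<Sum>i<n. int n * (\<gamma> i)\<^sup>2 + 2 * int i * \<gamma> i))"
    proof -
      have "den_coeff n d = den_base n * p powi (\<Sum>i<n. int n * (\<gamma> i)\<^sup>2 + 2 * int i * \<gamma> i)"
        using IH unfolding d_def .
      then show ?thesis by (simp only: q_powi mult_ac)
    qed
    also have "p powi (2 * (d i - d j + int n)) * p powi (\<Sum>i<n. int n * (\<gamma> i)\<^sup>2 + 2 * int i * \<gamma> i)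
       = p powi (\<Sum>i<n. int n * (\<beta> i)\<^sup>2 + 2 * int i * \<beta> i)"
    proof -
      have "(\<Sum>k<n. int n * (\<gamma> k)\<^sup>2 + 2 * int k * \<gamma> k) = (\<Sum>k<n. int n * (\<beta> k)\<^sup>2 + 2 * int k * \<beta> k)
          - 2 * (d i - d j + int n)"
        using upd[of "\<lambda>k x. int n * x\<^sup>2 + 2 * int k * x"] i j ij
        by (simp add: d_def \<gamma>_def algebra_simps power2_eq_square)
      then show ?thesis using p_nz by (simp add: power_int_add[symmetric])
    qed
    finally show ?thesis .
  qed
qed

subsection \<open>The leading coefficient\<close>

text \<open>Sorting the factors by the residue of their index modulo \<open>n\<close> is a finite
  rearrangement for the first \<open>M * n\<close> of them; then \<open>M\<close> tends to
  infinity.\<close>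

lemma qpoch_dissect:
  assumes "n > 0"
  shows "(\<Prod>i<n. qpoch (a * q ^ i) (q ^ n)) = qpoch a q"
proof (rule LIMSEQ_unique)
  have qn: "norm (q ^ n) < 1" using q_lt assms by (simp add: norm_power power_less_one_iff)
  show "(\<lambda>M. \<Prod>i<n. \<Prod>k<M. 1 - (a * q ^ i) * (q ^ n) ^ k) \<longlonglongrightarrow> (\<Prod>i<n. qpoch (a * q ^ i) (q ^ n))"
    by (intro tendsto_prod qpoch_LIMSEQ qn)
  have "filterlim (\<lambda>M. M * n) at_top sequentially"
    using assms by (intro mult_nat_right_at_top)
  from filterlim_compose[OF qpoch_LIMSEQ[OF q_lt, of a] this]
  have "(\<lambda>M. \<Prod>k<M * n. 1 - a * q ^ k) \<longlonglongrightarrow> qpoch a q" .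
  also have "(\<lambda>M. \<Prod>k<M * n. 1 - a * q ^ k) = (\<lambda>M. \<Prod>i<n. \<Prod>k<M. 1 - (a * q ^ i) * (q ^ n) ^ k)"
  proof
    fix M
    have "(\<Prod>k<M * n. 1 - a * q ^ k) = (\<Prod>k<M. \<Prod>m = k * n..<k * n + n. 1 - a * q ^ m)"
      by (rule prod.nat_group[symmetric])
    also have "\<dots> = (\<Prod>k<M. \<Prod>i<n. 1 - (a * q ^ i) * (q ^ n) ^ k)"
    proof (rule prod.cong[OF refl])
      fix k
      have "(\<Prod>m = k * n..<k * n + n. 1 - a * q ^ m) = (\<Prod>i = 0..<n. 1 - a * q ^ (i + k * n))"
        using prod.shift_bounds_nat_ivl[of "\<lambda>m. 1 - a * q ^ m" 0 "k * n" n] by (simp add: add.commute)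
      then show "(\<Prod>m = k * n..<k * n + n. 1 - a * q ^ m) = (\<Prod>i<n. 1 - (a * q ^ i) * (q ^ n) ^ k)"
        by (simp add: atLeast0LessThan power_add power_mult[symmetric] mult_ac)
    qed
    also have "\<dots> = (\<Prod>i<n. \<Prod>k<M. 1 - (a * q ^ i) * (q ^ n) ^ k)"
      by (rule prod.swap)
    finally show "(\<Prod>k<M * n. 1 - a * q ^ k) = (\<Prod>i<n. \<Prod>k<M. 1 - (a * q ^ i) * (q ^ n) ^ k)" .
  qed
  finally show "(\<lambda>M. \<Prod>i<n. \<Prod>k<M. 1 - (a * q ^ i) * (q ^ n) ^ k) \<longlonglongrightarrow> qpoch a q" .
qed

text \<open>The left-hand side is the constant term in $z$ of a product of $n$ theta series of nome $p^n$, whose product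
  forms recombine into a single theta function of nome $p$.\<close>

lemma core_generating_function:
  assumes n: "n > 0"
  shows "((\<lambda>\<beta>. p powi (\<Sum>i<n. int n * (\<beta> i)\<^sup>2 + 2 * int i * \<beta> i)) has_sum
      (qpoch (q ^ n) (q ^ n) ^ n / qpoch q q)) {\<beta> \<in> exponents n. (\<Sum>i<n. \<beta> i) = 0}"
proof -
  define w where "w \<beta> = p powi (\<Sum>i<n. int n * (\<beta> i)\<^sup>2 + 2 * int i * \<beta> i)" for \<beta> :: "nat \<Rightarrow> int"
  define g where "g i a = p powi (int n * a\<^sup>2 + 2 * int i * a)" for i :: nat and a :: int
  define K where "K = qpoch (q ^ n) (q ^ n) ^ n * inverse (qpoch q q)"
  define F where "F z = K * (qpoch q q * qpoch (p * (- (p ^ n) / p * z)) q * qpoch (p / (- (p ^ n) / p * z)) q)" for z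
  have pn: "p ^ n \<noteq> 0" "norm (p ^ n) < 1"
    using p_nz p_lt n by (auto simp: norm_power power_less_one_iff)
  have S1: "((\<lambda>\<beta>. w \<beta> * z powi (\<Sum>i<n. \<beta> i)) has_sum F z) (exponents n)" if z: "z \<noteq> 0" for z
  proof -
    have "((\<lambda>a. g i a * z powi a) has_sum
       (qpoch (q ^ n) (q ^ n) * qpoch (- (p ^ n) * z * q ^ i) (q ^ n) * qpoch (- (p ^ n) / z / q ^ i) (q ^ n))) UNIV" for i
    proof -
      \<comment> \<open>The triple product is taken with nome \<open>p ^ n\<close> at
        \<open>- (q ^ i) * z\<close>; the minus sign cancels the alternating signs of the
        series.\<close>
      have Z: "- (q ^ i) * z \<noteq> 0" using z q_nz by auto
      have "(p ^ n)\<^sup>2 = q ^ n" by (simp only: power_mult[symmetric] mult.commute)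
      moreover have "p ^ n * (- (q ^ i) * z) = - (p ^ n) * z * q ^ i" by simp
      moreover have "p ^ n / (- (q ^ i) * z) = - (p ^ n) / z / q ^ i" by simp
      moreover have "(-1) powi a * (p ^ n) powi (a\<^sup>2) * (- (q ^ i) * z) powi a = g i a * z powi a" for a
      proof -
        have "(- (q ^ i) * z) powi a = (-1) powi a * (p powi (2 * int i * a) * z powi a)"
        proof -
          have "- (q ^ i) * z = (-1) * (p powi (2 * int i) * z)"
            by (simp add: power_int_mult)
          then show ?thesis by (simp only: power_int_mult_distrib power_int_mult)
        qed
        moreover have "(p ^ n) powi (a\<^sup>2) = p powi (int n * a\<^sup>2)"
          by (simp only: power_int_mult power_int_of_nat)
        moreover have "(-1) powi a * (-1) powi a = (1 :: complex)"
          by (simp add: power_int_mult_distrib[symmetric])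
        ultimately show ?thesis
          using p_nz by (simp add: g_def power_int_add mult_ac)
      qed
      ultimately show ?thesis
        using jacobi_triple_product[OF pn Z] by (simp only:)
    qed
    then have "((\<lambda>\<beta>. \<Prod>i<n. g i (\<beta> i) * z powi \<beta> i) has_sum
       (\<Prod>i<n. qpoch (q ^ n) (q ^ n) * qpoch (- (p ^ n) * z * q ^ i) (q ^ n) * qpoch (- (p ^ n) / z / q ^ i) (q ^ n))) (exponents n)"
      by (rule has_sum_prod_exponents)
    also have "(\<lambda>\<beta>. \<Prod>i<n. g i (\<beta> i) * z powi \<beta> i) = (\<lambda>\<beta>. w \<beta> * z powi (\<Sum>i<n. \<beta> i))"
      by (simp add: fun_eq_iff w_def g_def prod.distrib power_int_sum[OF z] power_int_sum[OF p_nz])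
    also have "(\<Prod>i<n. qpoch (q ^ n) (q ^ n) * qpoch (- (p ^ n) * z * q ^ i) (q ^ n) * qpoch (- (p ^ n) / z / q ^ i) (q ^ n))
       = qpoch (q ^ n) (q ^ n) ^ n * qpoch (- (p ^ n) * z) q * (\<Prod>i<n. qpoch (- (p ^ n) / z / q ^ i) (q ^ n))"
      by (simp only: prod.distrib prod_constant card_lessThan qpoch_dissect[OF n])
    \<comment> \<open>Here the powers of \<open>q\<close> stand in the denominator. Reversing the
      index and starting from the smallest argument makes them ascend, as
      \<open>qpoch_dissect\<close> requires.\<close>
    also have "(\<Prod>i<n. qpoch (- (p ^ n) / z / q ^ i) (q ^ n)) = (\<Prod>i<n. qpoch (- (p ^ n) / z / q ^ (n - Suc i)) (q ^ n))"
      by (rule prod.nat_diff_reindex[symmetric])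
    also have "\<dots> = (\<Prod>i<n. qpoch (- (p ^ n) / z / q ^ (n - 1) * q ^ i) (q ^ n))"
    proof (rule prod.cong[OF refl])
      fix i assume "i \<in> {..<n}"
      then have "q ^ (n - 1) = q ^ (n - Suc i) * q ^ i"
        by (simp add: power_add[symmetric])
      then show "qpoch (- (p ^ n) / z / q ^ (n - Suc i)) (q ^ n) = qpoch (- (p ^ n) / z / q ^ (n - 1) * q ^ i) (q ^ n)"
        using q_nz by simp
    qed
    also have "\<dots> = qpoch (- (p ^ n) / z / q ^ (n - 1)) q"
      by (rule qpoch_dissect[OF n])
    also have "- (p ^ n) / z / q ^ (n - 1) = p / (- (p ^ n) / p * z)"
    proof -
      obtain m where m: "n = Suc m" using n by (cases n) auto
      show ?thesis using p_nz z unfolding m by (simp add: field_simps power_mult[symmetric] power_add[symmetric] mult_2 power2_eq_square power_mult_distrib)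
    qed
    also have "- (p ^ n) * z = p * (- (p ^ n) / p * z)"
      using p_nz by simp
    finally have "((\<lambda>\<beta>. w \<beta> * z powi (\<Sum>i<n. \<beta> i)) has_sum qpoch (q ^ n) (q ^ n) ^ n *
        qpoch (p * (- (p ^ n) / p * z)) q * qpoch (p / (- (p ^ n) / p * z)) q) (exponents n)" .
    moreover have cancel: "X * inverse Q * (Q * B * C) = X * B * C" if "Q \<noteq> 0" for X Q B C :: complex
      using that by simp
    ultimately show ?thesis
      by (simp only: F_def K_def cancel[OF qpoch_self_nonzero[OF q_lt]])
  qed
  define f where "f k = K * ((-1) powi k * p powi (k\<^sup>2) * (- (p ^ n) / p) powi k)" for k
  have S2: "((\<lambda>k. f k * z powi k) has_sum F z) UNIV" if z: "z \<noteq> 0" for z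
  proof -
    have "((\<lambda>k. K * ((-1) powi k * p powi (k\<^sup>2) * (- (p ^ n) / p * z) powi k)) has_sum F z) UNIV"
      unfolding F_def using z pn by (intro has_sum_cmult_right jacobi_triple_product p_nz p_lt) auto
    then show ?thesis
      by (simp only: f_def power_int_mult_distrib mult.assoc)
  qed
  \<comment> \<open>The two expansions of \<open>F\<close> are now compared by their constant terms
    in \<open>z\<close>: the first leaves the lattice vectors of sum 0, the second only
    \<open>k = 0\<close> with value \<open>K\<close>.\<close>
  have "(w has_sum (LINT \<theta>|torus 1. F (cis (\<theta> 0)))) {\<beta> \<in> exponents n. \<forall>i::nat<1. (\<Sum>i<n. \<beta> i) = 0}"
    using torus_integral_has_sum(2)[OF countable_exponents, where f = w and M = 1 and \<phi> = "\<lambda>\<beta> _. \<Sum>i<n. \<beta> i"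
        and F = "\<lambda>\<theta>. F (cis (\<theta> 0))"] S1 by simp
  moreover have "(f has_sum (LINT \<theta>|torus 1. F (cis (\<theta> 0)))) {k \<in> UNIV. \<forall>i::nat<1. k = 0}"
    using torus_integral_has_sum(2)[where C = UNIV and f = f and M = 1 and \<phi> = "\<lambda>k _. k"
        and F = "\<lambda>\<theta>. F (cis (\<theta> 0))"] S2 by simp
  then have "(LINT \<theta>|torus 1. F (cis (\<theta> 0))) = K"
    by (simp add: has_sum_finite_iff f_def)
  ultimately show ?thesis
    by (simp add: w_def[abs_def] K_def divide_inverse)
qed

section \<open>Support of the coefficients and specialisation at roots of unity\<close>

lemma den_coeff_perm_lattice:
  assumes \<sigma>: "\<sigma> permutes {..<n}" and \<beta>: "\<beta> \<in> exponents n" "(\<Sum>i<n. \<beta> i) = 0"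
  shows "den_coeff n (\<lambda>i. if i < n then int (\<sigma> i) + int n * \<beta> (\<sigma> i) else 0) =
    of_int (sign \<sigma>) * (den_base n * p powi (\<Sum>i<n. int n * (\<beta> i)\<^sup>2 + 2 * int i * \<beta> i))"
proof -
  let ?c = "\<lambda>i. if i < n then int i + int n * \<beta> i else 0"
  have "(\<lambda>i. if i < n then int (\<sigma> i) + int n * \<beta> (\<sigma> i) else 0) = ?c \<circ> \<sigma>"
    using permutes_in_image[OF \<sigma>] by (auto simp: fun_eq_iff)
  moreover have "?c \<in> exponents n" by (auto simp: exponents_def)
  ultimately show ?thesis
    using den_coeff_permute[OF \<sigma>, of ?c] den_coeff_lattice[OF \<beta>] by simp
qed

text \<open>By \<open>den_coeff_eq_0\<close> the entries have distinct residues modulo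
  \<open>n\<close>, so the residues form a permutation; homogeneity then forces the quotients to sum
  to 0.\<close>

lemma den_coeff_support:
  assumes c: "c \<in> exponents n" and nz: "den_coeff n c \<noteq> 0"
  obtains \<sigma> \<beta> where "\<sigma> permutes {..<n}" "\<beta> \<in> exponents n" "(\<Sum>i<n. \<beta> i) = 0"
    "c = (\<lambda>i. if i < n then int (\<sigma> i) + int n * \<beta> (\<sigma> i) else 0)"
proof -
  define \<sigma> where "\<sigma> = (\<lambda>i. if i < n then nat (c i mod int n) else i)"
  have \<sigma>_int: "int (\<sigma> i) = c i mod int n" if "i < n" for i
    using that by (simp add: \<sigma>_def)
  have "inj_on \<sigma> {..<n}"
  proof (rule inj_onI)
    fix i j assume "i \<in> {..<n}" "j \<in> {..<n}" "\<sigma> i = \<sigma> j"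
    then have "c i mod int n = c j mod int n" "i < n" "j < n"
      using \<sigma>_int[of i] \<sigma>_int[of j] by auto
    then show "i = j" using den_coeff_eq_0[OF c] nz by blast
  qed
  moreover have "\<sigma> ` {..<n} \<subseteq> {..<n}"
  proof (rule image_subsetI)
    fix i assume "i \<in> {..<n}"
    then have i: "i < n" by simp
    then have "int (\<sigma> i) < int n" unfolding \<sigma>_int[OF i] by (intro pos_mod_bound) auto
    then show "\<sigma> i \<in> {..<n}" by simp
  qed
  ultimately have "bij_betw \<sigma> {..<n} {..<n}"
    by (simp add: bij_betw_def endo_inj_surj)
  then have \<sigma>: "\<sigma> permutes {..<n}"
    by (rule bij_imp_permutes) (auto simp: \<sigma>_def)
  \<comment> \<open>The quotients are indexed by residue rather than by position, so that
    \<open>c\<close> is a lattice translate of (0, ..., n - 1) composed with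
    \<open>\<sigma>\<close>.\<close>
  define \<beta> where "\<beta> = (\<lambda>k. if k < n then c (inv_into UNIV \<sigma> k) div int n else 0)"
  have \<beta>\<sigma>: "\<beta> (\<sigma> i) = c i div int n" if "i < n" for i
    using that permutes_in_image[OF \<sigma>, of i] permutes_inverses[OF \<sigma>] by (simp add: \<beta>_def)
  have eq: "c = (\<lambda>i. if i < n then int (\<sigma> i) + int n * \<beta> (\<sigma> i) else 0)"
    using c by (auto simp: fun_eq_iff exponents_def \<sigma>_int \<beta>\<sigma> not_less)
  have bij: "bij_betw \<sigma> {..<n} {..<n}" by fact
  have "(\<Sum>i<n. int i) = (\<Sum>i<n. c i)"
    using den_coeff_homogeneous[OF c nz] by simp
  also have "\<dots> = (\<Sum>i<n. int (\<sigma> i)) + int n * (\<Sum>i<n. \<beta> (\<sigma> i))"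
    by (subst eq) (simp add: sum.distrib sum_distrib_left)
  also have "(\<Sum>i<n. int (\<sigma> i)) = (\<Sum>i<n. int i)"
    by (rule sum.reindex_bij_betw[OF bij])
  also have "(\<Sum>i<n. \<beta> (\<sigma> i)) = (\<Sum>i<n. \<beta> i)"
    by (rule sum.reindex_bij_betw[OF bij])
  finally have "int n * (\<Sum>i<n. \<beta> i) = 0" by simp
  then have "(\<Sum>i<n. \<beta> i) = 0" by (cases "n = 0") auto
  then show ?thesis
    using that[OF \<sigma> _ _ eq] by (simp add: \<beta>_def exponents_def)
qed

text \<open>The lattice part of each exponent is a multiple of \<open>n\<close> and becomes
  invisible in the monomial. The sum over the support thus factors into the Leibniz sum of the
  Vandermonde product and the generating function of the lattice.\<close>

lemma affine_den_roots_of_unity: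
  fixes y :: "nat \<Rightarrow> complex"
  assumes n: "n > 0" and y: "\<And>i. y i ^ n = 1"
  shows "affine_den p n y = (\<Prod>j<n. \<Prod>i<j. y j - y i) * (den_base n * (qpoch (q ^ n) (q ^ n) ^ n / qpoch q q))"
proof -
  define L where "L = {\<beta> \<in> exponents n. (\<Sum>i<n. \<beta> i) = 0}"
  define S where "S = {\<sigma>. \<sigma> permutes {..<n}}"
  define \<Phi> where "\<Phi> = (\<lambda>(\<sigma>, \<beta>). \<lambda>i. if i < n then int (\<sigma> i) + int n * \<beta> (\<sigma> i) else 0)"
  define w where "w \<beta> = p powi (\<Sum>i<n. int n * (\<beta> i)\<^sup>2 + 2 * int i * \<beta> i)" for \<beta> :: "nat \<Rightarrow> int"
  define E where "E = qpoch (q ^ n) (q ^ n) ^ n / qpoch q q"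
  define h where "h c = den_coeff n c * (\<Prod>i<n. y i powi c i)" for c
  have y_nz: "y i \<noteq> 0" for i using y[of i] n by (auto simp: power_0_left)
  have "(h has_sum affine_den p n y) (exponents n)"
    unfolding h_def by (rule laurentD[OF laurent_affine_den]) (rule y_nz)
  also have "?this \<longleftrightarrow> (h has_sum affine_den p n y) (\<Phi> ` (S \<times> L))"
  proof (rule has_sum_cong_neutral)
    fix c assume "c \<in> exponents n - \<Phi> ` (S \<times> L)"
    then show "h c = 0"
      using den_coeff_support[of c n] unfolding h_def S_def L_def \<Phi>_def
      by (cases "den_coeff n c = 0") (auto simp: image_iff)
  qed (auto simp: \<Phi>_def exponents_def)
  also have "\<dots> \<longleftrightarrow> (h \<circ> \<Phi> has_sum affine_den p n y) (S \<times> L)"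
  proof (rule has_sum_reindex, rule inj_onI)
    fix a b assume a: "a \<in> S \<times> L" and b: "b \<in> S \<times> L" and eq: "\<Phi> a = \<Phi> b"
    obtain \<sigma> \<beta> where a': "a = (\<sigma>, \<beta>)" by (cases a)
    obtain \<tau> \<gamma> where b': "b = (\<tau>, \<gamma>)" by (cases b)
    have \<sigma>: "\<sigma> permutes {..<n}" and \<tau>: "\<tau> permutes {..<n}"
      using a b a' b' by (auto simp: S_def)
    have *: "\<sigma> i = \<tau> i \<and> \<beta> (\<sigma> i) = \<gamma> (\<tau> i)" if i: "i < n" for i
    proof -
      have lt: "\<sigma> i < n" "\<tau> i < n"
        using i permutes_in_image[OF \<sigma>, of i] permutes_in_image[OF \<tau>, of i] by auto
      have e: "int (\<sigma> i) + int n * \<beta> (\<sigma> i) = int (\<tau> i) + int n * \<gamma> (\<tau> i)"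
        using fun_cong[OF eq, of i] i by (simp add: \<Phi>_def a' b')
      have "int (\<sigma> i) = int (\<tau> i)"
        using arg_cong[OF e, of "\<lambda>x. x mod int n"] lt by simp
      with e n show ?thesis by simp
    qed
    have "\<sigma> = \<tau>"
    proof
      show "\<sigma> i = \<tau> i" for i
        using * permutes_not_in[OF \<sigma>, of i] permutes_not_in[OF \<tau>, of i] by (cases "i < n") auto
    qed
    moreover have "\<beta> = \<gamma>"
    proof
      fix k
      show "\<beta> k = \<gamma> k"
      proof (cases "k < n")
        case True
        then obtain i where "i < n" "\<sigma> i = k"
          using permutes_image[OF \<sigma>] by (metis imageE lessThan_iff)
        then show ?thesis using * by metis
      next
        case False
        then show ?thesis using a b by (auto simp: a' b' L_def exponents_def)
      qed
    qed
    ultimately show "a = b" by (simp add: a' b')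
  qed
  finally have sum: "(h \<circ> \<Phi> has_sum affine_den p n y) (S \<times> L)" .
  define s where "s \<sigma> = of_int (sign \<sigma>) * (\<Prod>i<n. y i ^ \<sigma> i)" for \<sigma> :: "nat \<Rightarrow> nat"
  have inner: "((\<lambda>\<beta>. (h \<circ> \<Phi>) (\<sigma>, \<beta>)) has_sum s \<sigma> * (den_base n * E)) L" if "\<sigma> \<in> S" for \<sigma>
  proof -
    have "((\<lambda>\<beta>. s \<sigma> * (den_base n * w \<beta>)) has_sum s \<sigma> * (den_base n * E)) L"
      unfolding w_def E_def L_def by (intro has_sum_cmult_right core_generating_function n)
    moreover have "(h \<circ> \<Phi>) (\<sigma>, \<beta>) = s \<sigma> * (den_base n * w \<beta>)" if "\<beta> \<in> L" for \<beta>
    proof -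
      have "(\<Prod>i<n. y i powi \<Phi> (\<sigma>, \<beta>) i) = (\<Prod>i<n. y i ^ \<sigma> i)"
        using y_nz by (intro prod.cong) (auto simp: \<Phi>_def power_int_add power_int_mult y)
      then show ?thesis
        using that \<open>\<sigma> \<in> S\<close> den_coeff_perm_lattice[of \<sigma> n \<beta>]
        by (simp add: h_def \<Phi>_def S_def L_def s_def w_def)
    qed
    ultimately show ?thesis
      using has_sum_cong by (metis (no_types, lifting))
  qed
  have "((\<lambda>\<sigma>. s \<sigma> * (den_base n * E)) has_sum affine_den p n y) S"
    by (rule has_sum_SigmaD[OF sum inner])
  moreover have "finite S" unfolding S_def by (intro finite_permutations) auto
  ultimately have "affine_den p n y = (\<Sum>\<sigma>\<in>S. s \<sigma>) * (den_base n * E)"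
    by (simp add: has_sum_finite_iff sum_distrib_right)
  then show ?thesis
    by (simp only: s_def S_def vandermonde_leibniz E_def)
qed

text \<open>The specialised series is compared with the product form. At the distinct powers of a
  primitive root the Vandermonde product \<open>V\<close> is nonzero and cancels, leaving
  \<open>(X / Q) ^ n = den_base n * (X ^ n / Q)\<close>.\<close>

theorem den_base_eq:
  assumes n: "n > 0"
  shows "den_base n = inverse (qpoch q q) ^ (n - 1)"
proof -
  define \<omega> where "\<omega> = cis (2 * pi / real n)"
  define y where "y i = \<omega> ^ i" for i :: nat
  have pw: "y j = cis (2 * pi * real j / real n)" for j
  proof -
    have "real j * (2 * pi / real n) = 2 * pi * real j / real n" by simp
    then show ?thesis by (simp only: y_def \<omega>_def Complex.DeMoivre)
  qed
  have bij: "bij_betw y {..<n} {z. z ^ n = 1}"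
    using Complex.bij_betw_roots_unity[OF n] by (simp only: pw[abs_def])
  have \<omega>n: "\<omega> ^ n = 1" using n by (simp add: \<omega>_def Complex.DeMoivre)
  have yn: "y i ^ n = 1" for i
    by (simp add: y_def power_mult[symmetric] mult.commute[of i]) (simp add: power_mult \<omega>n)
  have y_nz: "y i \<noteq> 0" for i by (simp add: y_def \<omega>_def)
  have qn: "norm (q ^ n) < 1" using q_lt n by (simp add: norm_power power_less_one_iff)
  define X where "X = qpoch (q ^ n) (q ^ n)"
  define Q where "Q = qpoch q q"
  have X: "X \<noteq> 0" unfolding X_def by (rule qpoch_self_nonzero[OF qn])
  have Q: "Q \<noteq> 0" unfolding Q_def by (rule qpoch_self_nonzero[OF q_lt])
  define V where "V = (\<Prod>j<n. \<Prod>i<j. y j - y i)"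
  have V: "V \<noteq> 0"
  proof -
    have "y j - y i \<noteq> 0" if "j < n" "i < j" for i j
      using that inj_onD[OF bij_betw_imp_inj_on[OF bij], of j i] by auto
    then show ?thesis by (auto simp: V_def)
  qed
  \<comment> \<open>Over a full row the factors of each level \<open>k\<close> multiply to
    \<open>1 - q ^ n * (q ^ n) ^ k\<close> and so give \<open>X\<close>; the omitted diagonal factor
    is \<open>Q\<close>.\<close>
  have row: "(\<Prod>j\<in>{..<n} - {i}. qpoch (q * (y i / y j)) q) = X / Q" if i: "i < n" for i
  proof -
    have "(\<Prod>j<n. qpoch (q * (y i / y j)) q) = X"
    proof (rule LIMSEQ_unique)
      show "(\<lambda>M. \<Prod>j<n. \<Prod>k<M. 1 - q * (y i / y j) * q ^ k) \<longlonglongrightarrow> (\<Prod>j<n. qpoch (q * (y i / y j)) q)"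
        by (intro tendsto_prod qpoch_LIMSEQ q_lt)
      have "(\<lambda>M. \<Prod>k<M. 1 - q ^ n * (q ^ n) ^ k) \<longlonglongrightarrow> X"
        unfolding X_def by (rule qpoch_LIMSEQ[OF qn])
      also have "(\<lambda>M. \<Prod>k<M. 1 - q ^ n * (q ^ n) ^ k) = (\<lambda>M. \<Prod>j<n. \<Prod>k<M. 1 - q * (y i / y j) * q ^ k)"
      proof
        fix M
        have "(\<Prod>j<n. \<Prod>k<M. 1 - q * (y i / y j) * q ^ k) = (\<Prod>k<M. \<Prod>j<n. 1 - (q * y i * q ^ k) / \<omega> ^ j)"
          by (subst prod.swap) (simp add: y_def)
        also have "\<dots> = (\<Prod>k<M. 1 - (q * y i * q ^ k) ^ n)"
          unfolding \<omega>_def prod_one_minus_roots_of_unity[OF n] ..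
        also have "\<dots> = (\<Prod>k<M. 1 - q ^ n * (q ^ n) ^ k)"
        proof -
          have "(q ^ k) ^ n = (q ^ n) ^ k" for k
            by (metis power_mult mult.commute)
          then show ?thesis by (simp only: power_mult_distrib yn mult_1_right)
        qed
        finally show "(\<Prod>k<M. 1 - q ^ n * (q ^ n) ^ k) = (\<Prod>j<n. \<Prod>k<M. 1 - q * (y i / y j) * q ^ k)" ..
      qed
      finally show "(\<lambda>M. \<Prod>j<n. \<Prod>k<M. 1 - q * (y i / y j) * q ^ k) \<longlonglongrightarrow> X" .
    qed
    moreover have "(\<Prod>j<n. qpoch (q * (y i / y j)) q) = qpoch (q * (y i / y i)) q * (\<Prod>j\<in>{..<n} - {i}. qpoch (q * (y i / y j)) q)"
      using i by (intro prod.remove) auto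
    ultimately show ?thesis
      using Q y_nz[of i] by (simp add: Q_def field_simps)
  qed
  have "(\<Prod>i<n. \<Prod>j\<in>{..<n} - {i}. qpoch (q * (y i / y j)) q) = (\<Prod>i<n. X / Q)"
    by (intro prod.cong[OF refl] row) simp
  then have "V * (X / Q) ^ n = affine_den p n y"
    unfolding V_def using affine_den_eq[OF y_nz, of n] by simp
  also have "\<dots> = V * (den_base n * (X ^ n / Q))"
    unfolding V_def X_def Q_def by (rule affine_den_roots_of_unity[OF n yn])
  finally have "(X / Q) ^ n = den_base n * (X ^ n / Q)"
    by (rule mult_left_cancel[OF V, THEN iffD1])
  then have "den_base n = Q / Q ^ n"
    using X Q by (simp add: field_simps power_divide)
  also have "\<dots> = inverse Q ^ (n - 1)"
    using Q n by (cases n) (auto simp: field_simps)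
  finally show ?thesis by (simp add: Q_def)
qed

end

subsection \<open>The character integral\<close>

lemma svar_nz: "svar N \<theta> i \<noteq> 0"
  by (simp add: svar_def)

text \<open>Eliminating the last variable, the inverse of the product of the others, subtracts its
  exponent from every remaining one.\<close>

lemma prod_svar_powi:
  assumes "N \<ge> 1"
  shows "(\<Prod>i<N. svar N \<theta> i powi e i) = (\<Prod>i<N - 1. cis (\<theta> i) powi (e i - e (N - 1)))"
proof -
  obtain M where N: "N = Suc M" using assms by (cases N) auto
  have "(\<Prod>i<N. svar N \<theta> i powi e i) = (\<Prod>i<M. cis (\<theta> i) powi e i) * inverse (\<Prod>j<M. cis (\<theta> j)) powi e M"
    by (simp add: N svar_def)
  also have "inverse (\<Prod>j<M. cis (\<theta> j)) powi e M = (\<Prod>j<M. cis (\<theta> j) powi (- e M))"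
    by (simp only: power_int_minus power_int_inverse prod_inversef[symmetric, unfolded o_def] power_int_prod)
  finally show ?thesis
    by (simp add: N prod.distrib[symmetric] power_int_add[symmetric])
qed

context nome
begin

text \<open>For each pair, (1 - z_i/z_j) (1 - z_j/z_i) = (z_j - z_i) (1/z_j - 1/z_i). The first
  factor is absorbed into the affine denominator; the second gives a Vandermonde product in the
  inverses, whose Leibniz expansion yields the exponents \<open>- int (\<sigma> i)\<close>. The
  power \<open>p ^ N\<close> offsets the \<open>N\<close> factors
  \<open>y N = 1 / p\<close>.\<close>

lemma Wintegrand_eq:
  fixes N :: nat and m :: int and x :: complex
  assumes x: "x \<noteq> 0"
  defines "y \<equiv> \<lambda>\<theta> i. if i < N then x * svar N \<theta> i else 1 / p"
  shows "Wintegrand N m x p \<theta> = (\<Sum>\<sigma> | \<sigma> permutes {..<N}. \<Sum>j<N. x powi (- m) * p ^ N * of_int (sign \<sigma>) *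
     ((\<Prod>i<N. y \<theta> i powi ((if i = j then m else 0) - int (\<sigma> i))) * affine_den p (Suc N) (y \<theta>)))"
proof -
  define s where "s = svar N \<theta>"
  define z where "z i = x * s i" for i
  have s_nz: "s i \<noteq> 0" for i by (simp add: s_def svar_nz)
  have z_nz: "z i \<noteq> 0" for i using s_nz x by (simp add: z_def)
  have yz: "y \<theta> i = z i" if "i < N" for i using that by (simp add: y_def z_def s_def)
  have yN: "y \<theta> N = 1 / p" by (simp add: y_def)
  define A where "A = affine_den p N z"
  define T where "T = (\<Prod>i<N. qpoch (p * s i * x) q * qpoch (p / (s i * x)) q)"
  have AN: "affine_den p N (y \<theta>) = A"
    unfolding A_def affine_den_def by (intro prod.cong refl) (auto simp: yz)
  have full: "p ^ N * affine_den p (Suc N) (y \<theta>) = A * T"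
  proof -
    have "affine_den p (Suc N) (y \<theta>) = A * (\<Prod>i<N. (1 / p) * (qpoch (p * s i * x) q * qpoch (p / (s i * x)) q))"
    proof -
      have "(\<Prod>i<N. y \<theta> N * qtheta p (y \<theta> i / y \<theta> N)) = (\<Prod>i<N. (1 / p) * (qpoch (p * s i * x) q * qpoch (p / (s i * x)) q))"
      proof (rule prod.cong[OF refl])
        fix i assume "i \<in> {..<N}"
        then have e1: "y \<theta> i / y \<theta> N = p * s i * x" by (simp add: yz yN z_def mult_ac)
        have e2: "q / (p * s i * x) = p / (s i * x)"
          using p_nz s_nz x by (simp add: power2_eq_square)
        show "y \<theta> N * qtheta p (y \<theta> i / y \<theta> N) = (1 / p) * (qpoch (p * s i * x) q * qpoch (p / (s i * x)) q)"
          by (simp only: e1, simp only: qtheta_def e2 yN)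
      qed
      moreover have "affine_den p (Suc N) (y \<theta>) = affine_den p N (y \<theta>) * (\<Prod>i<N. y \<theta> N * qtheta p (y \<theta> i / y \<theta> N))"
        by (simp add: affine_den_def)
      ultimately show ?thesis by (simp only: AN)
    qed
    also have "\<dots> = A * ((1 / p) ^ N * T)"
      by (simp only: T_def prod.distrib prod_constant card_lessThan)
    finally show ?thesis using p_nz by (simp add: power_divide)
  qed
  have den: "(\<Prod>i<N. \<Prod>j\<in>{..<N} - {i}. qpoch (s i / s j) q) = A * (\<Prod>j<N. \<Prod>i<j. inverse (z j) - inverse (z i))"
  proof -
    have "(\<Prod>i<N. \<Prod>j\<in>{..<N} - {i}. qpoch (s i / s j) q) = (\<Prod>i<N. \<Prod>j\<in>{..<N} - {i}. (1 - z i / z j) * qpoch (q * (z i / z j)) q)"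
    proof -
      have "qpoch (s i / s j) q = (1 - z i / z j) * qpoch (q * (z i / z j)) q" for i j
        using x by (subst qpoch_rec[OF q_lt]) (simp add: z_def mult_ac)
      then show ?thesis by simp
    qed
    also have "\<dots> = (\<Prod>i<N. \<Prod>j\<in>{..<N} - {i}. 1 - z i / z j) * (\<Prod>i<N. \<Prod>j\<in>{..<N} - {i}. qpoch (q * (z i / z j)) q)"
      by (simp only: prod.distrib)
    also have "(\<Prod>i<N. \<Prod>j\<in>{..<N} - {i}. 1 - z i / z j) = (\<Prod>j<N. \<Prod>i<j. (z j - z i) * (inverse (z j) - inverse (z i)))"
      unfolding prod_offdiag by (intro prod.cong refl) (use z_nz in \<open>simp add: field_simps\<close>)
    also have "\<dots> = (\<Prod>j<N. \<Prod>i<j. z j - z i) * (\<Prod>j<N. \<Prod>i<j. inverse (z j) - inverse (z i))"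
      by (simp only: prod.distrib)
    finally show ?thesis
      unfolding A_def affine_den_eq[OF z_nz] by (simp only: mult_ac)
  qed
  have pows: "(\<Sum>i<N. s i powi m) = x powi (- m) * (\<Sum>i<N. z i powi m)"
    using x by (simp add: z_def power_int_mult_distrib power_int_minus sum_distrib_left[symmetric])
  have mono: "(\<Prod>i<N. inverse (z i) ^ \<sigma> i) * z j powi m = (\<Prod>i<N. y \<theta> i powi ((if i = j then m else 0) - int (\<sigma> i)))"
    if "j < N" for \<sigma> j
  proof -
    have "z j powi m = (\<Prod>i<N. if i = j then z i powi m else 1)"
      using that by simp
    then have "(\<Prod>i<N. inverse (z i) ^ \<sigma> i) * z j powi m = (\<Prod>i<N. inverse (z i) ^ \<sigma> i * (if i = j then z i powi m else 1))"
      by (simp only: prod.distrib)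
    also have "\<dots> = (\<Prod>i<N. y \<theta> i powi ((if i = j then m else 0) - int (\<sigma> i)))"
      using z_nz by (intro prod.cong refl) (auto simp: yz power_int_diff power_int_minus power_inverse divide_inverse)
    finally show ?thesis .
  qed
  have "Wintegrand N m x p \<theta> = (A * (\<Prod>j<N. \<Prod>i<j. inverse (z j) - inverse (z i))) * T * (x powi (- m) * (\<Sum>i<N. z i powi m))"
    unfolding Wintegrand_def Let_def s_def[symmetric] den T_def pows ..
  also have "\<dots> = x powi (- m) * (A * T) * ((\<Sum>\<sigma> | \<sigma> permutes {..<N}. of_int (sign \<sigma>) * (\<Prod>i<N. inverse (z i) ^ \<sigma> i)) * (\<Sum>j<N. z j powi m))"
    unfolding vandermonde_leibniz by (simp only: mult_ac)
  also have "\<dots> = (\<Sum>\<sigma> | \<sigma> permutes {..<N}. \<Sum>j<N. x powi (- m) * (A * T) * (of_int (sign \<sigma>) * ((\<Prod>i<N. inverse (z i) ^ \<sigma> i) * z j powi m)))"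
    by (simp only: sum_product, simp only: sum_distrib_left mult.assoc)
  also have "\<dots> = (\<Sum>\<sigma> | \<sigma> permutes {..<N}. \<Sum>j<N. x powi (- m) * p ^ N * of_int (sign \<sigma>) *
     ((\<Prod>i<N. y \<theta> i powi ((if i = j then m else 0) - int (\<sigma> i))) * affine_den p (Suc N) (y \<theta>)))"
  proof (intro sum.cong refl)
    fix \<sigma> :: "nat \<Rightarrow> nat" and j assume "j \<in> {..<N}"
    then have "j < N" by simp
    show "x powi (- m) * (A * T) * (of_int (sign \<sigma>) * ((\<Prod>i<N. inverse (z i) ^ \<sigma> i) * z j powi m)) =
      x powi (- m) * p ^ N * of_int (sign \<sigma>) *
     ((\<Prod>i<N. y \<theta> i powi ((if i = j then m else 0) - int (\<sigma> i))) * affine_den p (Suc N) (y \<theta>))"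
      unfolding mono[OF \<open>j < N\<close>] full[symmetric] by (simp only: mult_ac)
  qed
  finally show ?thesis .
qed

text \<open>On the torus \<open>\<Prod>i<N. s i = 1\<close>, a monomial in the \<open>s i\<close> has constant term 1 exactly if all exponents equal some
  \<open>k\<close>; the last entry is then dictated by homogeneity.\<close>

definition char_exponent :: "nat \<Rightarrow> int \<Rightarrow> (nat \<Rightarrow> nat) \<Rightarrow> nat \<Rightarrow> int \<Rightarrow> nat \<Rightarrow> int" where
  "char_exponent N m \<sigma> j k = (\<lambda>i. if i < N then k + int (\<sigma> i) - (if i = j then m else 0)
     else if i = N then int N - int N * k + m else 0)"

lemma char_exponent_in: "char_exponent N m \<sigma> j k \<in> exponents (Suc N)"
  by (auto simp: char_exponent_def exponents_def)

text \<open>Shifting at the last coordinate is the same as lowering \<open>k\<close> by 1. The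
  quasi-periodicity thus becomes a first-order recursion in \<open>k\<close>, which the stated
  factor also satisfies with value 1 at \<open>k = 0\<close>; the multipliers \<open>u k\<close> are
  nonzero, so it determines the coefficients in both directions. This is where the theta series of
  the result originates.\<close>

lemma den_coeff_char_exponent:
  "den_coeff (Suc N) (char_exponent N m \<sigma> j k) =
     (-1) powi (int N * k) * p powi (int N * k\<^sup>2 - int N * k - 2 * m * k) * den_coeff (Suc N) (char_exponent N m \<sigma> j 0)"
proof -
  define a where "a k = den_coeff (Suc N) (char_exponent N m \<sigma> j k)" for k
  define r where "r k = (-1) powi (int N * k) * p powi (int N * k\<^sup>2 - int N * k - 2 * m * k)" for k
  define u where "u k = (-1) ^ N * q powi (int N - int N * k + m)" for k
  have u_nz: "u k \<noteq> 0" for k using q_nz by (simp add: u_def)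
  have a_step: "a (k - 1) = u k * a k" for k
  proof -
    have "den_shift (Suc N) N (char_exponent N m \<sigma> j k) = char_exponent N m \<sigma> j (k - 1)"
      by (auto simp: fun_eq_iff den_shift_def char_exponent_def algebra_simps)
    then show ?thesis
      using den_coeff_shift[OF char_exponent_in, of N N m \<sigma> j k]
      by (simp add: a_def u_def char_exponent_def)
  qed
  have r_step: "r (k - 1) = u k * r k" for k
  proof -
    have e1: "int N * (k - 1)\<^sup>2 - int N * (k - 1) - 2 * m * (k - 1) =
      2 * (int N - int N * k + m) + (int N * k\<^sup>2 - int N * k - 2 * m * k)"
      by (simp add: power2_eq_square algebra_simps)
    have e2: "(-1) powi (int N * (k - 1)) = (-1) ^ N * ((-1) powi (int N * k) :: complex)"
    proof -
      have "int N * (k - 1) = int N * k - int N" by (simp add: algebra_simps)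
      then have "(-1) powi (int N * (k - 1)) = (-1) powi (int N * k) / ((-1) ^ N :: complex)"
        by (simp only: power_int_diff[of "-1::complex", OF disjI1] power_int_of_nat) (simp add: power_int_diff)
      moreover have "inverse ((-1) ^ N) = ((-1) ^ N :: complex)"
        by (simp add: power_inverse[symmetric])
      ultimately show ?thesis by (simp add: divide_inverse)
    qed
    show ?thesis
      unfolding r_def u_def e1 e2 q_powi power_int_add[OF disjI1[OF p_nz]] by (simp only: mult_ac)
  qed
  have "a k = r k * a 0"
  proof (induction k rule: int_induct[where k = 0])
    case base
    then show ?case by (simp add: r_def)
  next
    case (step1 i)
    have "u (i + 1) * a (i + 1) = a i" using a_step[of "i + 1"] by simp
    also have "\<dots> = r i * a 0" by (rule step1)
    also have "r i = u (i + 1) * r (i + 1)" using r_step[of "i + 1"] by simp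
    finally have "u (i + 1) * a (i + 1) = u (i + 1) * (r (i + 1) * a 0)" by (simp only: mult.assoc)
    then show ?case by (rule mult_left_cancel[OF u_nz, THEN iffD1])
  next
    case (step2 i)
    then show ?case using a_step[of i] r_step[of i] by simp
  qed
  then show ?thesis by (simp add: a_def r_def)
qed

text \<open>\<open>e c i\<close> is the exponent of \<open>svar N \<theta> i\<close> in the term at
  \<open>c\<close>, and \<open>f c\<close> collects what does not depend on the angles: the
  coefficient, the power of \<open>y N = 1 / p\<close> and the power of \<open>x\<close>. On the
  surviving line all \<open>e c i\<close> equal \<open>k\<close>, so \<open>x\<close> appears with
  exponent \<open>int N * k\<close>.\<close>

lemma char_term_integral:
  fixes N j :: nat and m :: int and x :: complex and \<sigma> :: "nat \<Rightarrow> nat"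
  assumes N: "N \<ge> 1" and x: "x \<noteq> 0" and \<sigma>: "\<sigma> permutes {..<N}" and j: "j < N"
  defines "y \<equiv> \<lambda>\<theta> i. if i < N then x * svar N \<theta> i else 1 / p"
  defines "G \<equiv> \<lambda>\<theta>. (\<Prod>i<N. y \<theta> i powi ((if i = j then m else 0) - int (\<sigma> i))) * affine_den p (Suc N) (y \<theta>)"
  shows "integrable (torus (N - 1)) G"
    and "(LINT \<theta>|torus (N - 1). G \<theta>) = den_coeff (Suc N) (char_exponent N m \<sigma> j 0) * p powi (- int N - m) *
      (\<Sum>\<^sub>\<infinity>k. (-1) powi (int N * k) * x powi (int N * k) * p powi (int N * k\<^sup>2 - 2 * m * k))"
proof -
  define e where "e c i = c i + ((if i = j then m else 0) - int (\<sigma> i))" for c :: "nat \<Rightarrow> int" and i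
  define f where "f c = den_coeff (Suc N) c * p powi (- c N) * x powi (\<Sum>i<N. e c i)" for c
  have y_nz: "y \<theta> i \<noteq> 0" for \<theta> i using x p_nz by (simp add: y_def svar_nz)
  have G: "((\<lambda>c. f c * (\<Prod>i<N - 1. cis (\<theta> i) powi (e c i - e c (N - 1)))) has_sum G \<theta>) (exponents (Suc N))" for \<theta>
  proof -
    have "((\<lambda>c. den_coeff (Suc N) c * (\<Prod>i<Suc N. y \<theta> i powi c i)) has_sum affine_den p (Suc N) (y \<theta>)) (exponents (Suc N))"
      by (intro laurentD[OF laurent_affine_den] y_nz)
    from has_sum_cmult_right[OF this]
    have "((\<lambda>c. (\<Prod>i<N. y \<theta> i powi ((if i = j then m else 0) - int (\<sigma> i))) * (den_coeff (Suc N) c * (\<Prod>i<Suc N. y \<theta> i powi c i))) has_sum G \<theta>) (exponents (Suc N))"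
      unfolding G_def .
    also have "(\<lambda>c. (\<Prod>i<N. y \<theta> i powi ((if i = j then m else 0) - int (\<sigma> i))) * (den_coeff (Suc N) c * (\<Prod>i<Suc N. y \<theta> i powi c i)))
       = (\<lambda>c. f c * (\<Prod>i<N - 1. cis (\<theta> i) powi (e c i - e c (N - 1))))"
    proof
      fix c
      have "(\<Prod>i<N. y \<theta> i powi ((if i = j then m else 0) - int (\<sigma> i))) * (\<Prod>i<N. y \<theta> i powi c i) = (\<Prod>i<N. y \<theta> i powi e c i)"
        unfolding prod.distrib[symmetric] e_def using y_nz by (intro prod.cong refl) (simp add: power_int_add[symmetric] add.commute)
      also have "\<dots> = (\<Prod>i<N. x powi e c i) * (\<Prod>i<N. svar N \<theta> i powi e c i)"
        unfolding prod.distrib[symmetric] by (intro prod.cong refl) (simp add: y_def power_int_mult_distrib)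
      also have "\<dots> = x powi (\<Sum>i<N. e c i) * (\<Prod>i<N - 1. cis (\<theta> i) powi (e c i - e c (N - 1)))"
        by (simp only: power_int_sum[OF x] prod_svar_powi[OF N])
      finally have *: "(\<Prod>i<N. y \<theta> i powi ((if i = j then m else 0) - int (\<sigma> i))) * (\<Prod>i<N. y \<theta> i powi c i) =
          x powi (\<Sum>i<N. e c i) * (\<Prod>i<N - 1. cis (\<theta> i) powi (e c i - e c (N - 1)))" .
      have "y \<theta> N powi c N = p powi (- c N)"
        by (simp add: y_def power_int_minus power_int_inverse divide_inverse)
      then have "(\<Prod>i<N. y \<theta> i powi ((if i = j then m else 0) - int (\<sigma> i))) * (den_coeff (Suc N) c * (\<Prod>i<Suc N. y \<theta> i powi c i))
         = den_coeff (Suc N) c * p powi (- c N) * ((\<Prod>i<N. y \<theta> i powi ((if i = j then m else 0) - int (\<sigma> i))) * (\<Prod>i<N. y \<theta> i powi c i))"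
        by simp
      then show "(\<Prod>i<N. y \<theta> i powi ((if i = j then m else 0) - int (\<sigma> i))) * (den_coeff (Suc N) c * (\<Prod>i<Suc N. y \<theta> i powi c i))
         = f c * (\<Prod>i<N - 1. cis (\<theta> i) powi (e c i - e c (N - 1)))"
        unfolding * f_def by (simp only: mult.assoc)
    qed
    finally show ?thesis .
  qed
  show "integrable (torus (N - 1)) G"
    by (rule torus_integral_has_sum(1)[OF countable_exponents G])
  define I where "I = (LINT \<theta>|torus (N - 1). G \<theta>)"
  let ?\<gamma> = "char_exponent N m \<sigma> j"
  have e_\<gamma>: "e (?\<gamma> k) i = k" if "i < N" for i k
    using that by (simp add: e_def char_exponent_def)
  have "e (?\<gamma> k) i - e (?\<gamma> k) (N - 1) = 0" if "i < N - 1" for i k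
    using that N by (simp add: e_\<gamma>)
  then have sub: "range ?\<gamma> \<subseteq> {c \<in> exponents (Suc N). \<forall>i<N - 1. e c i - e c (N - 1) = 0}"
    using char_exponent_in by blast
  have "(f has_sum I) {c \<in> exponents (Suc N). \<forall>i<N - 1. e c i - e c (N - 1) = 0}"
    unfolding I_def by (rule torus_integral_has_sum(2)[OF countable_exponents G])
  also have "?this \<longleftrightarrow> (f has_sum I) (range ?\<gamma>)"
  proof (rule has_sum_cong_neutral)
    fix c assume "c \<in> range ?\<gamma> - {c \<in> exponents (Suc N). \<forall>i<N - 1. e c i - e c (N - 1) = 0}"
    then show "f c = 0"
      using sub by blast
  next
    fix c assume c: "c \<in> {c \<in> exponents (Suc N). \<forall>i<N - 1. e c i - e c (N - 1) = 0} - range ?\<gamma>"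
    have "den_coeff (Suc N) c = 0"
    proof (rule ccontr)
      assume nz: "den_coeff (Suc N) c \<noteq> 0"
      define k where "k = e c (N - 1)"
      have ek: "e c i = k" if "i < N" for i
        using c that N by (cases "i = N - 1") (auto simp: k_def)
      have ci: "c i = k + int (\<sigma> i) - (if i = j then m else 0)" if "i < N" for i
        using ek[OF that] by (simp add: e_def)
      have "(\<Sum>i<Suc N. c i) = (\<Sum>i<Suc N. int i)"
        using c nz by (intro den_coeff_homogeneous) auto
      moreover have "(\<Sum>i<N. c i) = int N * k + (\<Sum>i<N. int (\<sigma> i)) - m"
        using j by (simp add: ci sum.distrib sum_subtractf)
      moreover have "(\<Sum>i<N. int (\<sigma> i)) = (\<Sum>i<N. int i)"
        by (rule sum.reindex_bij_betw[OF permutes_imp_bij[OF \<sigma>]])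
      ultimately have "c N = int N - int N * k + m" by simp
      then have "c = ?\<gamma> k"
        using c ci by (auto simp: fun_eq_iff char_exponent_def exponents_def)
      then show False using c by blast
    qed
    then show "f c = 0" by (simp add: f_def)
  qed auto
  also have "\<dots> \<longleftrightarrow> (f \<circ> ?\<gamma> has_sum I) UNIV"
  proof (rule has_sum_reindex, rule injI)
    fix k l assume "?\<gamma> k = ?\<gamma> l"
    from fun_cong[OF this, of 0] show "k = l"
      using N by (simp add: char_exponent_def split: if_splits)
  qed
  finally have "(f \<circ> ?\<gamma> has_sum I) UNIV" .
  also have "f \<circ> ?\<gamma> = (\<lambda>k. (den_coeff (Suc N) (?\<gamma> 0) * p powi (- int N - m)) *
      ((-1) powi (int N * k) * x powi (int N * k) * p powi (int N * k\<^sup>2 - 2 * m * k)))"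
  proof
    fix k
    have "(\<Sum>i<N. e (?\<gamma> k) i) = int N * k" by (simp add: e_\<gamma>)
    then have "f (?\<gamma> k) = den_coeff (Suc N) (?\<gamma> k) * p powi (- (int N - int N * k + m)) * x powi (int N * k)"
      by (simp only: f_def) (simp add: char_exponent_def)
    also have "\<dots> = den_coeff (Suc N) (?\<gamma> 0) * ((-1) powi (int N * k) * x powi (int N * k)) *
       (p powi (int N * k\<^sup>2 - int N * k - 2 * m * k) * p powi (- (int N - int N * k + m)))"
      unfolding den_coeff_char_exponent[of N m \<sigma> j k] by (simp only: mult_ac)
    \<comment> \<open>The linear term \<open>- int N * k\<close> of the coefficient cancels against
      the power of \<open>y N\<close>, leaving the exponent of the theta series.\<close>
    also have "p powi (int N * k\<^sup>2 - int N * k - 2 * m * k) * p powi (- (int N - int N * k + m))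
       = p powi (- int N - m) * p powi (int N * k\<^sup>2 - 2 * m * k)"
      using p_nz by (simp add: power_int_add[symmetric] algebra_simps)
    finally show "(f \<circ> ?\<gamma>) k = (den_coeff (Suc N) (?\<gamma> 0) * p powi (- int N - m)) *
      ((-1) powi (int N * k) * x powi (int N * k) * p powi (int N * k\<^sup>2 - 2 * m * k))"
      by (simp add: mult_ac)
  qed
  finally have "I = (\<Sum>\<^sub>\<infinity>k. (den_coeff (Suc N) (?\<gamma> 0) * p powi (- int N - m)) *
      ((-1) powi (int N * k) * x powi (int N * k) * p powi (int N * k\<^sup>2 - 2 * m * k)))"
    by (simp only: infsumI)
  then show "(LINT \<theta>|torus (N - 1). G \<theta>) = den_coeff (Suc N) (?\<gamma> 0) * p powi (- int N - m) *
      (\<Sum>\<^sub>\<infinity>k. (-1) powi (int N * k) * x powi (int N * k) * p powi (int N * k\<^sup>2 - 2 * m * k))"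
    unfolding I_def infsum_cmult_right' .
qed

text \<open>Removing \<open>\<sigma>\<close> from the exponent produces a second copy of its sign,
  which will cancel the one from the Leibniz expansion.\<close>

lemma den_coeff_char_exponent_perm:
  assumes \<sigma>: "\<sigma> permutes {..<N}"
  shows "den_coeff (Suc N) (char_exponent N m \<sigma> j 0) = of_int (sign \<sigma>) * den_coeff (Suc N) (char_exponent N m id (\<sigma> j) 0)"
proof -
  have "\<sigma> permutes {..<Suc N}"
    using \<sigma> by (rule permutes_subset) auto
  moreover have "char_exponent N m \<sigma> j 0 = char_exponent N m id (\<sigma> j) 0 \<circ> \<sigma>"
    using permutes_in_image[OF \<sigma>] permutes_not_in[OF \<sigma>] inj_eq[OF permutes_inj[OF \<sigma>]]
    by (auto simp: fun_eq_iff char_exponent_def)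
  ultimately show ?thesis
    using den_coeff_permute[OF _ char_exponent_in] by simp
qed

text \<open>Since the signs square to 1 and \<open>\<sigma>\<close> only permutes the index
  \<open>l\<close>, every permutation contributes the same sum; their number cancels the
  normalisation by \<open>fact N\<close>.\<close>

lemma Wm_eq:
  assumes N: "N \<ge> 1" and x: "x \<noteq> 0"
  shows "Wm N m x p = qpoch q q ^ (N - 1) * x powi (- m) * p powi (- m) * (\<Sum>l<N. den_coeff (Suc N) (char_exponent N m id l 0)) *
      (\<Sum>\<^sub>\<infinity>k. (-1) powi (int N * k) * x powi (int N * k) * p powi (int N * k\<^sup>2 - 2 * m * k))"
proof -
  define \<Theta> where "\<Theta> = (\<Sum>\<^sub>\<infinity>k. (-1) powi (int N * k) * x powi (int N * k) * p powi (int N * k\<^sup>2 - 2 * m * k))"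
  define y where "y \<theta> i = (if i < N then x * svar N \<theta> i else 1 / p)" for \<theta> i
  define G where "G \<sigma> j \<theta> = (\<Prod>i<N. y \<theta> i powi ((if i = j then m else 0) - int (\<sigma> i))) * affine_den p (Suc N) (y \<theta>)" for \<sigma> j \<theta>
  define b where "b l = den_coeff (Suc N) (char_exponent N m id l 0)" for l
  define S where "S = {\<sigma>. \<sigma> permutes {..<N}}"
  have int: "integrable (torus (N - 1)) (G \<sigma> j)"
      "(LINT \<theta>|torus (N - 1). G \<sigma> j \<theta>) = den_coeff (Suc N) (char_exponent N m \<sigma> j 0) * p powi (- int N - m) * \<Theta>"
    if "\<sigma> permutes {..<N}" "j < N" for \<sigma> j
    unfolding G_def[abs_def] y_def[abs_def] \<Theta>_def by (rule char_term_integral[OF N x that])+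
  have Gint: "integrable (torus (N - 1)) (G \<sigma> j)" if "\<sigma> \<in> S" "j \<in> {..<N}" for \<sigma> j
    using that unfolding S_def by (intro int(1)) simp_all
  have W: "Wintegrand N m x p = (\<lambda>\<theta>. \<Sum>\<sigma>\<in>S. \<Sum>j<N. x powi (- m) * p ^ N * of_int (sign \<sigma>) * G \<sigma> j \<theta>)"
    unfolding S_def G_def y_def[abs_def] by (rule ext) (rule Wintegrand_eq[OF x])
  have "(LINT \<theta>|torus (N - 1). Wintegrand N m x p \<theta>) =
     (\<Sum>\<sigma>\<in>S. LINT \<theta>|torus (N - 1). (\<Sum>j<N. x powi (- m) * p ^ N * of_int (sign \<sigma>) * G \<sigma> j \<theta>))"
    unfolding W by (intro Bochner_Integration.integral_sum Bochner_Integration.integrable_sum integrable_mult_right Gint)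
  also have "\<dots> = (\<Sum>\<sigma>\<in>S. \<Sum>j<N. LINT \<theta>|torus (N - 1). x powi (- m) * p ^ N * of_int (sign \<sigma>) * G \<sigma> j \<theta>)"
    by (intro sum.cong refl Bochner_Integration.integral_sum integrable_mult_right Gint)
  also have "\<dots> = (\<Sum>\<sigma>\<in>S. \<Sum>j<N. x powi (- m) * p powi (- m) * \<Theta> * b (\<sigma> j))"
  proof (intro sum.cong refl)
    fix \<sigma> j assume "\<sigma> \<in> S" "j \<in> {..<N}"
    then have \<sigma>: "\<sigma> permutes {..<N}" and j: "j < N" by (auto simp: S_def)
    have sgn: "of_int (sign \<sigma>) * of_int (sign \<sigma>) = (1 :: complex)"
      by (simp flip: of_int_mult)
    have pp: "p ^ N * p powi (- int N - m) = p powi (- m)"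
    proof -
      have "p ^ N * p powi (- int N - m) = p powi (int N) * p powi (- int N - m)" by simp
      also have "\<dots> = p powi (- m)" by (simp only: power_int_add[OF disjI1[OF p_nz], symmetric]) simp
      finally show ?thesis .
    qed
    have "(LINT \<theta>|torus (N - 1). x powi (- m) * p ^ N * of_int (sign \<sigma>) * G \<sigma> j \<theta>) =
      x powi (- m) * p ^ N * of_int (sign \<sigma>) * (LINT \<theta>|torus (N - 1). G \<sigma> j \<theta>)"
      by simp
    also have "\<dots> = x powi (- m) * (p ^ N * p powi (- int N - m)) * (of_int (sign \<sigma>) * of_int (sign \<sigma>)) * \<Theta> * b (\<sigma> j)"
      unfolding int(2)[OF \<sigma> j] den_coeff_char_exponent_perm[OF \<sigma>] b_def by (simp only: mult_ac)
    finally show "(LINT \<theta>|torus (N - 1). x powi (- m) * p ^ N * of_int (sign \<sigma>) * G \<sigma> j \<theta>) =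
        x powi (- m) * p powi (- m) * \<Theta> * b (\<sigma> j)"
      by (simp only: sgn pp mult_1_right)
  qed
  also have "\<dots> = (\<Sum>\<sigma>\<in>S. x powi (- m) * p powi (- m) * \<Theta> * (\<Sum>l<N. b l))"
  proof (rule sum.cong[OF refl])
    fix \<sigma> assume "\<sigma> \<in> S"
    then have "(\<Sum>j<N. b (\<sigma> j)) = (\<Sum>l<N. b l)"
      unfolding S_def by (intro sum.reindex_bij_betw permutes_imp_bij) auto
    then show "(\<Sum>j<N. x powi (- m) * p powi (- m) * \<Theta> * b (\<sigma> j)) = x powi (- m) * p powi (- m) * \<Theta> * (\<Sum>l<N. b l)"
      by (simp add: sum_distrib_left[symmetric])
  qed
  also have "\<dots> = of_nat (fact N) * (x powi (- m) * p powi (- m) * \<Theta> * (\<Sum>l<N. b l))"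
    by (simp add: S_def card_permutations[where n = N])
  finally show ?thesis
    unfolding Wm_def \<Theta>_def[symmetric] b_def[symmetric] by (simp add: mult_ac)
qed

section \<open>Evaluation of the \<open>N\<close> remaining coefficients\<close>

lemma den_base_updates:
  fixes N j :: nat and l :: int
  assumes j: "j < N"
  shows "den_coeff (Suc N) (\<lambda>i. if i < N then int i - (if i = j then int (Suc N) * l else 0)
      else if i = N then int N + int (Suc N) * l else 0) =
    p powi (2 * int (Suc N) * l\<^sup>2 + 2 * l * (int N - int j)) * inverse (qpoch q q) ^ N"
proof -
  define d where "d = (\<lambda>i. if i < Suc N then int i else 0)"
  have d: "d \<in> exponents (Suc N)" by (auto simp: d_def exponents_def)
  have "den_coeff (Suc N) d = inverse (qpoch q q) ^ N"
    using den_base_eq[of "Suc N"] by (simp add: den_base_def d_def)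
  moreover have "d(j := d j + int (Suc N) * (- l), N := d N - int (Suc N) * (- l)) =
     (\<lambda>i. if i < N then int i - (if i = j then int (Suc N) * l else 0)
      else if i = N then int N + int (Suc N) * l else 0)"
    using j by (auto simp: fun_eq_iff d_def)
  moreover have "2 * (- l) * (d j - d N) + 2 * int (Suc N) * (- l)\<^sup>2 = 2 * int (Suc N) * l\<^sup>2 + 2 * l * (int N - int j)"
    using j by (simp add: d_def algebra_simps)
  moreover have "j < Suc N" "N < Suc N" "j \<noteq> N" using j by auto
  note den_coeff_translate[OF d this, of "- l"]
  ultimately show ?thesis by (simp only:)
qed

text \<open>Each exponent vector is the translate of (0, ..., N) by \<open>t\<close> times N + 1
  along e_N - e_l. The quadratic part of the resulting power is common to all \<open>l\<close> and
  the rest is linear in \<open>l\<close>, so the coefficients form a geometric progression of ratio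
  \<open>q powi t\<close> in reversed order.\<close>

lemma sum_char_exponent_dvd:
  fixes N :: nat and t :: int
  assumes m: "m = int (Suc N) * t"
  shows "(\<Sum>l<N. den_coeff (Suc N) (char_exponent N m id l 0)) =
    inverse (qpoch q q) ^ N * p powi (2 * (m - int N) * t + 2 * m) *
      (if t = 0 then of_nat N else (1 - q powi (int N * t)) / (1 - q powi t))"
proof -
  define Q where "Q = inverse (qpoch q q) ^ N"
  have summand: "den_coeff (Suc N) (char_exponent N m id l 0) = Q * (p powi (2 * (m - int N) * t + 2 * m) * q powi (t * (int N - 1 - int l)))"
    if l: "l < N" for l
  proof -
    have "char_exponent N m id l 0 = (\<lambda>i. if i < N then int i - (if i = l then int (Suc N) * t else 0)
      else if i = N then int N + int (Suc N) * t else 0)"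
      by (auto simp: fun_eq_iff char_exponent_def m)
    moreover have "2 * int (Suc N) * t\<^sup>2 + 2 * t * (int N - int l) = (2 * (m - int N) * t + 2 * m) + 2 * (t * (int N - 1 - int l))"
      by (simp add: m algebra_simps power2_eq_square)
    ultimately show ?thesis
      using den_base_updates[OF l, of t] p_nz unfolding Q_def q_powi
      by (simp add: power_int_add)
  qed
  have "(\<Sum>l<N. q powi (t * (int N - 1 - int l))) = (\<Sum>l<N. q powi (t * (int N - 1 - int (N - Suc l))))"
    by (rule sum.nat_diff_reindex[symmetric])
  also have "\<dots> = (\<Sum>l<N. (q powi t) ^ l)"
    by (intro sum.cong refl) (simp add: of_nat_diff power_int_mult)
  also have "\<dots> = (if t = 0 then of_nat N else (1 - q powi (int N * t)) / (1 - q powi t))"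
  proof (cases "t = 0")
    case False
    have "q powi t \<noteq> 1"
    proof
      assume 1: "q powi t = 1"
      have "q ^ nat \<bar>t\<bar> = 1"
        using 1 by (cases "t \<ge> 0") (auto simp: power_int_def power_inverse)
      moreover obtain k where "nat \<bar>t\<bar> = Suc k" using False by (cases "nat \<bar>t\<bar>") auto
      ultimately show False using power_Suc_neq_1[OF q_lt, of k] by simp
    qed
    moreover have "q powi (int N * t) = (q powi t) ^ N"
      by (simp add: power_int_mult mult.commute[of "int N"])
    ultimately show ?thesis
      using False by (simp add: sum_gp_strict)
  qed simp
  finally show ?thesis
    by (simp add: summand sum_distrib_left[symmetric] Q_def)
qed

text \<open>With \<open>j + 1\<close> the residue of \<open>m\<close>, the last entry
  \<open>int N + m\<close> is congruent to \<open>j\<close>. It collides with the untouched entry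
  \<open>j\<close> unless \<open>l = j\<close>, so \<open>den_coeff_eq_0\<close> leaves a single
  summand.\<close>

lemma sum_char_exponent_not_dvd:
  fixes N :: nat and m :: int
  assumes N: "N \<ge> 1" and m: "m mod int (Suc N) \<noteq> 0"
  defines "t \<equiv> m div int (Suc N)"
  shows "(\<Sum>l<N. den_coeff (Suc N) (char_exponent N m id l 0)) =
    - (inverse (qpoch q q) ^ N * p powi (2 * m * t + 2 * m))"
proof -
  define j where "j = nat (m mod int (Suc N) - 1)"
  have "0 \<le> m mod int (Suc N)" by (rule pos_mod_sign) simp
  moreover have "m mod int (Suc N) < int (Suc N)" by (rule pos_mod_bound) simp
  ultimately have j: "j < N" and j': "m mod int (Suc N) = int j + 1"
    using m unfolding j_def by linarith+
  have mt: "m = int (Suc N) * t + int j + 1"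
    using mult_div_mod_eq[of "int (Suc N)" m] unfolding j' t_def by (simp only: add.assoc)
  let ?b = "\<lambda>l. char_exponent N m id l 0"
  have zero: "den_coeff (Suc N) (?b l) = 0" if l: "l \<in> {..<N}" "l \<noteq> j" for l
  proof (rule den_coeff_eq_0[OF char_exponent_in])
    have "?b l N = int j + int (Suc N) * (t + 1)"
      by (simp add: char_exponent_def mt algebra_simps)
    moreover have "?b l j = int j"
      using l j by (simp add: char_exponent_def)
    ultimately show "?b l N mod int (Suc N) = ?b l j mod int (Suc N)"
      by simp
  qed (use j in auto)
  have "(\<Sum>l<N. den_coeff (Suc N) (?b l)) = (\<Sum>l\<in>{j}. den_coeff (Suc N) (?b l))"
    using j zero by (intro sum.mono_neutral_right) auto
  \<comment> \<open>After exchanging entries \<open>j\<close> and \<open>N\<close> the vector is a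
    translate of (0, ..., N) by \<open>- (t + 1)\<close> times N + 1 along e_N - e_j; the exchange
    is the source of the minus sign in the result.\<close>
  also have "\<dots> = - den_coeff (Suc N) ((?b j)(j := ?b j N, N := ?b j j))"
    using den_coeff_swap[OF char_exponent_in, of j N N m id j 0] j by simp
  also have "(?b j)(j := ?b j N, N := ?b j j) = (\<lambda>i. if i < N then int i - (if i = j then int (Suc N) * (- (t + 1)) else 0)
      else if i = N then int N + int (Suc N) * (- (t + 1)) else 0)"
    using j by (auto simp: fun_eq_iff char_exponent_def mt algebra_simps)
  also have "den_coeff (Suc N) \<dots> = p powi (2 * int (Suc N) * (- (t + 1))\<^sup>2 + 2 * (- (t + 1)) * (int N - int j)) * inverse (qpoch q q) ^ N"
    by (rule den_base_updates[OF j])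
  also have "2 * int (Suc N) * (- (t + 1))\<^sup>2 + 2 * (- (t + 1)) * (int N - int j) = 2 * m * t + 2 * m"
    by (simp add: mt algebra_simps power2_eq_square)
  finally show ?thesis by (simp only: mult.commute)
qed

end

theorem theorem1p7:
  fixes N :: nat and m :: int and x p :: complex
  assumes "N \<ge> 2" and "x \<noteq> 0" and "p \<noteq> 0" and "norm p < 1"
  defines "q \<equiv> p ^ 2"
  defines "t \<equiv> m div (int N + 1)"
  defines "\<Theta> \<equiv> (\<Sum>\<^sub>\<infinity>k::int. (-1) powi (int N * k) * x powi (int N * k)
                                  * p powi (int N * k ^ 2 - 2 * m * k))"
  shows "(m mod (int N + 1) = 0 \<longrightarrow>
            Wm N m x p = 1 / qpoch q q * x powi (- m) * p powi (2 * (m - int N) * t + m)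
               * (if t = 0 then of_nat N else (1 - q powi (int N * t)) / (1 - q powi t)) * \<Theta>)
       \<and> (m mod (int N + 1) \<noteq> 0 \<longrightarrow>
            Wm N m x p = - (1 / qpoch q q * x powi (- m) * p powi (2 * m * t + m) * \<Theta>))"
proof -
  interpret nome p
    using assms by unfold_locales
  have N: "N \<ge> 1" using assms(1) by simp
  have Suc_N: "int N + 1 = int (Suc N)" by simp
  define S where "S = (\<Sum>l<N. den_coeff (Suc N) (char_exponent N m id l 0))"
  have W: "Wm N m x p = qpoch q q ^ (N - 1) * x powi (- m) * p powi (- m) * S * \<Theta>"
    unfolding S_def \<Theta>_def q_def by (rule Wm_eq[OF N assms(2)])
  \<comment> \<open>The prefactor of the integral supplies \<open>N - 1\<close> powers of the
    infinite product and the leading coefficient in \<open>N + 1\<close> variables removes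
    \<open>N\<close>.\<close>
  have Q: "qpoch q q ^ (N - 1) * inverse (qpoch q q) ^ N = 1 / qpoch q q"
  proof -
    obtain M where "N = Suc M" using N by (cases N) auto
    then show ?thesis
      using qpoch_self_nonzero[OF q_lt] unfolding q_def by (simp add: field_simps)
  qed
  have pm: "p powi (- m) * p powi (k + 2 * m) = p powi (k + m)" for k
    using p_nz by (simp add: power_int_add[symmetric] add.commute)
  show ?thesis
  proof (intro conjI impI)
    assume "m mod (int N + 1) = 0"
    then have "m = int (Suc N) * t"
      unfolding t_def Suc_N by (metis mult_div_mod_eq add.right_neutral)
    note S = sum_char_exponent_dvd[OF this, folded S_def q_def]
    have "Wm N m x p = (qpoch q q ^ (N - 1) * inverse (qpoch q q) ^ N) * x powi (- m) *
        (p powi (- m) * p powi (2 * (m - int N) * t + 2 * m))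
        * (if t = 0 then of_nat N else (1 - q powi (int N * t)) / (1 - q powi t)) * \<Theta>"
      unfolding W S by (simp only: mult_ac)
    then show "Wm N m x p = 1 / qpoch q q * x powi (- m) * p powi (2 * (m - int N) * t + m)
        * (if t = 0 then of_nat N else (1 - q powi (int N * t)) / (1 - q powi t)) * \<Theta>"
      unfolding Q pm .
  next
    assume "m mod (int N + 1) \<noteq> 0"
    then have "m mod int (Suc N) \<noteq> 0" unfolding Suc_N .
    note S = sum_char_exponent_not_dvd[OF N this, folded S_def q_def Suc_N, folded t_def]
    have "Wm N m x p = - ((qpoch q q ^ (N - 1) * inverse (qpoch q q) ^ N) * x powi (- m) *
        (p powi (- m) * p powi (2 * m * t + 2 * m)) * \<Theta>)"
      unfolding W S by simp
    then show "Wm N m x p = - (1 / qpoch q q * x powi (- m) * p powi (2 * m * t + m) * \<Theta>)"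
      unfolding Q pm .
  qed
qed

end
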